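(* Let $\{\mathbb{Q}_n\}_{n=0}^\infty=\{Q_{k,n}:0\le k\le n,\ n\in\mathbb{N}_0\}$, with $\mathbb{Q}_0=1$, be an arbitrary sequence in $\Pi^2(\mathbb{C})$, where $\mathbb{Q}_n=(Q_{0,n},\ldots,Q_{n,n})^{\mathsf t}$ is regarded as a column vector, and set $\mathbb{Q}_{-1}=0$. Then the following statements are equivalent. (1) There exists a positive definite linear functional $\mathcal{L}$ on $\Pi^2(\mathbb{C})$ which makes $\{\mathbb{Q}_n\}_{n=0}^\infty$ an orthonormal basis in $\Pi^2(\mathbb{C})$. (2) For $n\ge0$ there exist matrices $\alpha_n$ of size $(n+1)\times(n+2)$ and $\beta_n$ of size $(n+1)\times(n+1)$, with complex entries, such that $$z\,\mathbb{Q}_n(z,\bar z)=\alpha_n\mathbb{Q}_{n+1}(z,\bar z)+\beta_n\mathbb{Q}_n(z,\bar z)+(\alpha_{n-1}^* )^\vee\mathbb{Q}_{n-1}(z,\bar z)$$ (the last term being absent for $n=0$), and the matrices in the relation satisfy the rank condition $$\operatorname{rank}(\alpha_n+\alpha_n^\vee)=\operatorname{rank}(\alpha_n-\alpha_n^\vee)=n+1\quad\text{and}\quad \operatorname{rank}\begin{bmatrix}\alpha_n\\ \alpha_n^\vee\end{bmatrix}=n+2 .$$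
   Context: $\Pi^2(\mathbb{C})$ is the space of polynomials in $z$ and $\bar z$ with complex coefficients, where $z=x+iy$, $(x,y)\in\mathbb{R}^2$; $\Pi_n^2(\mathbb{C})$ is the subspace of those of total degree at most $n$, and $\Pi^2_{-1}(\mathbb{C})=\{0\}$. A linear functional $\mathcal{L}$ on $\Pi^2(\mathbb{C})$ is positive definite if $\mathcal{L}(p\,\overline{p})>0$ for every nonzero $p\in\Pi^2(\mathbb{C})$; it defines the inner product $\langle f,g\rangle=\mathcal{L}(f\overline{g})$. That $\mathcal{L}$ makes $\{\mathbb{Q}_n\}$ an orthonormal basis in $\Pi^2(\mathbb{C})$ means that for each $n$ the polynomials $Q_{0,n},\ldots,Q_{n,n}$ form an orthonormal basis, with respect to this inner product, of the space of orthogonal polynomials of degree $n$, $\{P\in\Pi_n^2(\mathbb{C}):\mathcal{L}(P\overline{Q})=0\ \forall Q\in\Pi_{n-1}^2(\mathbb{C})\}$. $J_n$ is the $n\times n$ backward identity matrix (ones on the antidiagonal, zeros elsewhere). For an $n\times m$ matrix $M$, $M^\vee:=J_n\overline{M}J_m$, where $\overline{M}$ is the entrywise complex conjugate; $M^{\mathsf t}$ is the transpose and $M^*$ the conjugate transpose.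
   Formalization: The formal theorem additionally assumes that the conjugate of Q_{k,n} equals Q_{n-k,n} for all 0≤k≤n (the column vector Q_n is fixed by conjugation followed by reversal of entries); without this assumption neither implication holds for an arbitrary sequence. *)

theory Defs
  imports "Jordan_Normal_Form.DL_Rank" "Jordan_Normal_Form.Schur_Decomposition"
begin

(* Polynomials in z and its conjugate are represented by the functions they induce on the complex
   plane; since z and its conjugate are x + iy and x - iy with x, y independent real variables, a
   polynomial is determined by its function.  The degree bound is an int so that the space of
   degree at most -1 is literally the zero space (empty sum). *)
definition poly_deg_le :: "int \<Rightarrow> (complex \<Rightarrow> complex) set" where
  "poly_deg_le d = {f. \<exists>c :: nat \<Rightarrow> nat \<Rightarrow> complex.
     f = (\<lambda>z. \<Sum>(i, j) \<in> {(i, j). int (i + j) \<le> d}. c i j * z ^ i * cnj z ^ j)}"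

definition poly_space :: "(complex \<Rightarrow> complex) set" where
  "poly_space = (\<Union>d. poly_deg_le d)"

(* Only the values of L on poly_space matter. *)
definition linear_functional :: "((complex \<Rightarrow> complex) \<Rightarrow> complex) \<Rightarrow> bool" where
  "linear_functional L \<longleftrightarrow>
     (\<forall>f \<in> poly_space. \<forall>g \<in> poly_space. L (\<lambda>z. f z + g z) = L f + L g) \<and>
     (\<forall>a. \<forall>f \<in> poly_space. L (\<lambda>z. a * f z) = a * L f)"

definition inner_prod ::
  "((complex \<Rightarrow> complex) \<Rightarrow> complex) \<Rightarrow> (complex \<Rightarrow> complex) \<Rightarrow> (complex \<Rightarrow> complex) \<Rightarrow> complex" where
  "inner_prod L f g = L (\<lambda>z. f z * cnj (g z))"

definition positive_definite :: "((complex \<Rightarrow> complex) \<Rightarrow> complex) \<Rightarrow> bool" where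
  "positive_definite L \<longleftrightarrow>
     (\<forall>p \<in> poly_space. p \<noteq> (\<lambda>z. 0) \<longrightarrow> inner_prod L p p \<in> \<real> \<and> Re (inner_prod L p p) > 0)"

definition orth_polys :: "((complex \<Rightarrow> complex) \<Rightarrow> complex) \<Rightarrow> nat \<Rightarrow> (complex \<Rightarrow> complex) set" where
  "orth_polys L n = {P \<in> poly_deg_le (int n). \<forall>q \<in> poly_deg_le (int n - 1). inner_prod L P q = 0}"

(* Throughout, Q k n stands for the polynomial with lower indices k, n (0 <= k <= n); the values
   with k > n are irrelevant. *)
definition makes_orthonormal_basis ::
  "((complex \<Rightarrow> complex) \<Rightarrow> complex) \<Rightarrow> (nat \<Rightarrow> nat \<Rightarrow> complex \<Rightarrow> complex) \<Rightarrow> bool" where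
  "makes_orthonormal_basis L Q \<longleftrightarrow> (\<forall>n.
     (\<forall>k\<le>n. Q k n \<in> orth_polys L n) \<and>
     (\<forall>k\<le>n. \<forall>l\<le>n. inner_prod L (Q k n) (Q l n) = (if k = l then 1 else 0)) \<and>
     (\<forall>P \<in> orth_polys L n. \<exists>c :: nat \<Rightarrow> complex. P = (\<lambda>z. \<Sum>k\<le>n. c k * Q k n z)))"

(* The standing normalisation of complex orthogonal polynomials: J times the conjugate of the
   column vector (Q 0 n, ..., Q n n) is that vector itself.  The relation between the coefficient
   of index n - 1 and that of index n + 1 in the three-term relation presupposes it: for Q not
   normalised in this way neither implication of the theorem holds in general. *)
definition conj_symmetric :: "(nat \<Rightarrow> nat \<Rightarrow> complex \<Rightarrow> complex) \<Rightarrow> bool" where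
  "conj_symmetric Q \<longleftrightarrow> (\<forall>n. \<forall>k\<le>n. Q (n - k) n = (\<lambda>z. cnj (Q k n z)))"

definition Qvec :: "(nat \<Rightarrow> nat \<Rightarrow> complex \<Rightarrow> complex) \<Rightarrow> nat \<Rightarrow> complex \<Rightarrow> complex vec" where
  "Qvec Q n z = vec (n + 1) (\<lambda>k. Q k n z)"

definition backward_id :: "nat \<Rightarrow> complex mat" where
  "backward_id n = mat n n (\<lambda>(i, j). if i + j + 1 = n then 1 else 0)"

definition mat_vee :: "complex mat \<Rightarrow> complex mat" where
  "mat_vee M = backward_id (dim_row M) * map_mat cnj M * backward_id (dim_col M)"

end

theory Submission
  imports Defs "HOL-Library.Function_Algebras"
begin

text \<open>
Write \<open>Q n\<close> for the column \<open>Q 0 n, ..., Q n n\<close> and \<open>\<langle>f, g\<rangle> = L (f * cnj g)\<close>. Because \<open>cnj (Q k n) = Q (n - k) n\<close>,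
conjugating the three-term relation and reversing the order of the entries gives a second relation,
for multiplication by \<open>cnj z\<close>, whose leading matrix is \<open>mat_vee (\<alpha> n)\<close> and whose lowest one is the
adjoint of \<open>\<alpha> (n - 1)\<close>. For every functional \<open>L\<close>, \<open>\<langle>f, g\<rangle> = \<langle>cnj g, cnj f\<rangle>\<close>, and multiplication by \<open>z\<close>
is adjoint to multiplication by \<open>cnj z\<close>.

Suppose that \<open>L\<close> makes \<open>Q\<close> orthonormal. Then every polynomial of degree at most \<open>n\<close> is the sum of its
Fourier terms \<open>\<langle>f, Q k m\<rangle> Q k m\<close> with \<open>m \<le> n\<close> (lemma \<open>expansion\<close>). For \<open>f = z * Q k n\<close> the terms with
\<open>m < n - 1\<close> vanish by adjointness, and those with \<open>m = n - 1\<close> are again entries of \<open>\<alpha> (n - 1)\<close>; this is the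
three-term relation. A vector in the kernel of the stacked matrix defines a functional that vanishes
on degree at most \<open>n\<close>, on \<open>z * Q k n\<close> and on \<open>cnj z * Q k n\<close>, hence on all of degree \<open>n + 1\<close>, so the
vector is zero (\<open>stacked_injective\<close>). A vanishing combination \<open>y\<close> of the rows of \<open>\<alpha> n \<plusminus> mat_vee (\<alpha> n)\<close> says
that multiplication by \<open>z \<plusminus> cnj z\<close> does not raise the degree of \<open>p = (\<Sum>k\<le>n. y k * Q k n)\<close>; comparing leading
coefficients, \<open>p\<close> has degree less than \<open>n\<close> (\<open>degree_drop\<close>). Being orthogonal to all such polynomials, it is
zero (\<open>combination_row_injective\<close>).

Conversely, suppose that the relation holds. The stacked matrix has full column rank, so it has a left
inverse, and \<open>Q (n + 1)\<close> can be solved for in terms of \<open>z * Q n\<close>, \<open>cnj z * Q n\<close>, \<open>Q n\<close> and \<open>Q (n - 1)\<close>. Hence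
\<open>Q k n\<close> has degree at most \<open>n\<close>, and, since multiplication by \<open>z\<close> and \<open>cnj z\<close> moves a level by at most
one, the levels up to \<open>n\<close> span the polynomials of degree at most \<open>n\<close>. They consist of as many functions as
there are monomials of that degree, so \<open>Q\<close> is a basis (\<open>graded_spanning_imp_basis\<close>). Let \<open>L\<close> be the
coefficient of \<open>Q 0 0 = 1\<close>. A monomial of degree less than \<open>n\<close> cannot move \<open>Q k n\<close> down to level \<open>0\<close>, which
gives orthogonality of different levels. Let \<open>H n\<close> be the Gram matrix of level \<open>n\<close>. Evaluating
\<open>\<langle>z * Q k n, Q l (n + 1)\<rangle>\<close> from both sides gives \<open>\<alpha> n H (n + 1) = H n \<alpha> n\<close>, and likewise for
\<open>mat_vee (\<alpha> n)\<close>; with \<open>H n = 1\<close> and the left inverse this forces \<open>H (n + 1) = 1\<close> (\<open>gram\<close>). Positivity of \<open>L\<close>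
is then Parseval's identity.
\<close>

section \<open>Polynomials in z and its conjugate as a graded vector space\<close>

text \<open>
All functions on the complex plane form a complex vector space. This makes spans, independence and
coordinates available for polynomials, which the definitions represent by the functions they induce.
\<close>

interpretation fs: vector_space "\<lambda>(a :: complex) (f :: complex \<Rightarrow> complex) z. a * f z"
  by standard (auto simp: fun_eq_iff algebra_simps)

lemma sum_fun_apply: "(\<Sum>i\<in>I. f i) z = (\<Sum>i\<in>I. f i z)" for f :: "_ \<Rightarrow> _ \<Rightarrow> 'a :: comm_monoid_add"
  by (induction I rule: infinite_finite_induct) auto

text \<open>
Induction over a span with the operations written out pointwise, as they occur in the definitions of
polynomials and linear functionals. The hypotheses on sums and multiples also provide membership in
the span, because linearity of a functional is known only for polynomials.
\<close>

lemma span_pointwise_induct [consumes 1, case_names zero add scale base]: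
  assumes f: "f \<in> fs.span S"
    and zero: "P (\<lambda>z. 0)"
    and add: "\<And>f g. f \<in> fs.span S \<Longrightarrow> g \<in> fs.span S \<Longrightarrow> P f \<Longrightarrow> P g \<Longrightarrow> P (\<lambda>z. f z + g z)"
    and scale: "\<And>a f. f \<in> fs.span S \<Longrightarrow> P f \<Longrightarrow> P (\<lambda>z. a * f z)"
    and base: "\<And>f. f \<in> S \<Longrightarrow> P f"
  shows "P f"
proof -
  have "f \<in> fs.span S \<and> P f" using f
  proof (induction rule: fs.span_induct)
    case base
    show ?case
      using zero add scale fs.span_zero fs.span_add fs.span_scale
      by (auto simp: fs.subspace_def zero_fun_def plus_fun_def)
  next
    case (step g)
    then show ?case using base fs.span_base by blast
  qed
  then show ?thesis ..
qed

lemma span_pw_zero: "(\<lambda>z. 0) \<in> fs.span S"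
  using fs.span_zero[of S] by (simp add: zero_fun_def)

lemma span_pw_add: "f \<in> fs.span S \<Longrightarrow> g \<in> fs.span S \<Longrightarrow> (\<lambda>z. f z + g z) \<in> fs.span S"
  using fs.span_add[of f S g] by (simp add: plus_fun_def)

lemma span_pw_diff: "f \<in> fs.span S \<Longrightarrow> g \<in> fs.span S \<Longrightarrow> (\<lambda>z. f z - g z) \<in> fs.span S"
  using fs.span_diff[of f S g] by (simp add: fun_diff_def)

lemma span_pw_sum:
  "(\<And>i. i \<in> I \<Longrightarrow> f i \<in> fs.span S) \<Longrightarrow> (\<lambda>z. \<Sum>i\<in>I. f i z) \<in> fs.span S"
  using fs.span_sum[of I f S] by (simp add: sum_fun_apply[abs_def] fun_eq_iff[symmetric] ext[OF sum_fun_apply])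

lemmas span_pw = span_pw_zero span_pw_add span_pw_diff span_pw_sum fs.span_scale

lemma span_finite_family:
  assumes "finite I"
  shows "fs.span (b ` I) = {f. \<exists>c. f = (\<lambda>z. \<Sum>i\<in>I. c i * b i z)}"
proof (intro subset_antisym subsetI)
  fix f assume "f \<in> fs.span (b ` I)"
  then show "f \<in> {f. \<exists>c. f = (\<lambda>z. \<Sum>i\<in>I. c i * b i z)}"
  proof (induction rule: span_pointwise_induct)
    case zero
    show ?case by (auto intro!: exI[of _ "\<lambda>_. 0"])
  next
    case (add f g)
    then obtain c d where "f = (\<lambda>z. \<Sum>i\<in>I. c i * b i z)" "g = (\<lambda>z. \<Sum>i\<in>I. d i * b i z)" by auto
    then show ?case by (auto intro!: exI[of _ "\<lambda>i. c i + d i"] simp: distrib_right sum.distrib)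
  next
    case (scale a f)
    then obtain c where "f = (\<lambda>z. \<Sum>i\<in>I. c i * b i z)" by auto
    then show ?case by (auto intro!: exI[of _ "\<lambda>i. a * c i"] simp: sum_distrib_left mult.assoc)
  next
    case (base f)
    then obtain k where k: "k \<in> I" "f = b k" by auto
    have "(\<Sum>i\<in>I. (if i = k then 1 else 0) * b i z) = b k z" for z
      using k(1) assms by (simp add: sum.remove[of I k])
    then show ?case using k by (auto intro!: exI[of _ "\<lambda>i. if i = k then 1 else 0"])
  qed
next
  fix f assume "f \<in> {f. \<exists>c. f = (\<lambda>z. \<Sum>i\<in>I. c i * b i z)}"
  then show "f \<in> fs.span (b ` I)" by (auto intro!: span_pw intro: fs.span_base)
qed

definition zmon :: "nat \<times> nat \<Rightarrow> complex \<Rightarrow> complex" where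
  "zmon = (\<lambda>(i, j) z. z ^ i * cnj z ^ j)"

lemma zmon_apply: "zmon (i, j) z = z ^ i * cnj z ^ j"
  by (simp add: zmon_def)

lemma finite_degree_le: "finite {(i :: nat, j :: nat). int (i + j) \<le> d}"
  by (rule finite_subset[of _ "{..nat d} \<times> {..nat d}"]) auto

lemma poly_deg_le_eq_span: "poly_deg_le d = fs.span (zmon ` {(i, j). int (i + j) \<le> d})"
proof -
  have "(\<exists>c. f = (\<lambda>z. \<Sum>(i, j)\<in>I. c i j * z ^ i * cnj z ^ j)) \<longleftrightarrow>
      (\<exists>c. f = (\<lambda>z. \<Sum>p\<in>I. c p * zmon p z))" for I :: "(nat \<times> nat) set" and f
  proof
    assume "\<exists>c. f = (\<lambda>z. \<Sum>(i, j)\<in>I. c i j * z ^ i * cnj z ^ j)"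
    then obtain c where "f = (\<lambda>z. \<Sum>(i, j)\<in>I. c i j * z ^ i * cnj z ^ j)" ..
    then show "\<exists>c. f = (\<lambda>z. \<Sum>p\<in>I. c p * zmon p z)"
      by (intro exI[of _ "case_prod c"]) (auto simp: zmon_def case_prod_beta mult.assoc)
  next
    assume "\<exists>c. f = (\<lambda>z. \<Sum>p\<in>I. c p * zmon p z)"
    then obtain c where "f = (\<lambda>z. \<Sum>p\<in>I. c p * zmon p z)" ..
    then show "\<exists>c. f = (\<lambda>z. \<Sum>(i, j)\<in>I. c i j * z ^ i * cnj z ^ j)"
      by (intro exI[of _ "curry c"]) (auto simp: zmon_def case_prod_beta mult.assoc)
  qed
  then show ?thesis
    unfolding poly_deg_le_def span_finite_family[OF finite_degree_le] by simp
qed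

lemma poly_deg_le_mono: "d \<le> e \<Longrightarrow> poly_deg_le d \<subseteq> poly_deg_le e"
  unfolding poly_deg_le_eq_span by (intro fs.span_mono image_mono) auto

lemma poly_space_eq_span: "poly_space = fs.span (range zmon)"
proof
  show "poly_space \<subseteq> fs.span (range zmon)"
    unfolding poly_space_def poly_deg_le_eq_span by (intro UN_least fs.span_mono) auto
  show "fs.span (range zmon) \<subseteq> poly_space"
  proof
    fix f assume "f \<in> fs.span (range zmon)"
    then show "f \<in> poly_space"
    proof (induction rule: span_pointwise_induct)
      case zero
      have "(\<lambda>z. 0) \<in> poly_deg_le 0" unfolding poly_deg_le_eq_span by (rule span_pw_zero)
      then show ?case unfolding poly_space_def by blast
    next
      case (add f g)
      then obtain d e where "f \<in> poly_deg_le d" "g \<in> poly_deg_le e" unfolding poly_space_def by blast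
      then have "f \<in> poly_deg_le (max d e)" "g \<in> poly_deg_le (max d e)"
        using poly_deg_le_mono[of d "max d e"] poly_deg_le_mono[of e "max d e"] by auto
      then have "(\<lambda>z. f z + g z) \<in> poly_deg_le (max d e)"
        unfolding poly_deg_le_eq_span by (rule span_pw_add)
      then show ?case unfolding poly_space_def by blast
    next
      case (scale a f)
      then obtain d where "f \<in> poly_deg_le d" unfolding poly_space_def by blast
      then have "(\<lambda>z. a * f z) \<in> poly_deg_le d" unfolding poly_deg_le_eq_span by (rule fs.span_scale)
      then show ?case unfolding poly_space_def by blast
    next
      case (base f)
      then obtain p where "f = zmon p" by auto
      then have "f \<in> poly_deg_le (int (fst p + snd p))"
        unfolding poly_deg_le_eq_span by (auto intro!: fs.span_base imageI)
      then show ?case unfolding poly_space_def by blast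
    qed
  qed
qed

lemma poly_deg_le_subset_poly_space: "poly_deg_le d \<subseteq> poly_space"
  unfolding poly_space_def by blast

lemma poly_space_obtain_degree:
  assumes "f \<in> poly_space" obtains n :: nat where "f \<in> poly_deg_le (int n)"
proof -
  from assms obtain d where "f \<in> poly_deg_le d" unfolding poly_space_def by blast
  then have "f \<in> poly_deg_le (int (nat d))" using poly_deg_le_mono[of d "int (nat d)"] by auto
  then show ?thesis by (rule that)
qed

lemmas poly_deg_le_zero = span_pw_zero[where S = "zmon ` {(i, j). int (i + j) \<le> d}" for d, folded poly_deg_le_eq_span]
lemmas poly_deg_le_add = span_pw_add[where S = "zmon ` {(i, j). int (i + j) \<le> d}" for d, folded poly_deg_le_eq_span]
lemmas poly_deg_le_diff = span_pw_diff[where S = "zmon ` {(i, j). int (i + j) \<le> d}" for d, folded poly_deg_le_eq_span]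
lemmas poly_deg_le_sum = span_pw_sum[where S = "zmon ` {(i, j). int (i + j) \<le> d}" for d, folded poly_deg_le_eq_span]
lemmas poly_deg_le_scale = fs.span_scale[where S = "zmon ` {(i, j). int (i + j) \<le> d}" for d, folded poly_deg_le_eq_span]
lemmas poly_deg_le_pw = poly_deg_le_zero poly_deg_le_add poly_deg_le_diff poly_deg_le_sum poly_deg_le_scale

lemmas poly_space_zero = span_pw_zero[where S = "range zmon", folded poly_space_eq_span]
lemmas poly_space_add = span_pw_add[where S = "range zmon", folded poly_space_eq_span]
lemmas poly_space_sum = span_pw_sum[where S = "range zmon", folded poly_space_eq_span]
lemmas poly_space_scale = fs.span_scale[where S = "range zmon", folded poly_space_eq_span]
lemmas poly_space_pw = poly_space_zero poly_space_add poly_space_sum poly_space_scale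

lemma span_subset_poly_space: "S \<subseteq> poly_space \<Longrightarrow> fs.span S \<subseteq> poly_space"
  unfolding poly_space_eq_span by (intro fs.span_minimal fs.subspace_span)

text \<open>
The form in which linearity is used most: a functional that is linear on polynomials only is still
determined on a span by its values on the generators.
\<close>

lemma linear_functional_zero_on_span:
  assumes \<phi>: "linear_functional \<phi>" and S: "S \<subseteq> poly_space"
    and vanish: "\<And>f. f \<in> S \<Longrightarrow> \<phi> f = 0" and f: "f \<in> fs.span S"
  shows "\<phi> f = 0"
  using f
proof (induction rule: span_pointwise_induct)
  case zero
  have "\<forall>a. \<forall>f \<in> poly_space. \<phi> (\<lambda>z. a * f z) = a * \<phi> f"
    using \<phi> unfolding linear_functional_def by blast
  from bspec[OF spec[OF this, of 0] poly_space_zero] show ?case by simp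
next
  case (add f g)
  then have "f \<in> poly_space" "g \<in> poly_space" using span_subset_poly_space[OF S] by auto
  then show ?case using \<phi> add.IH unfolding linear_functional_def by simp
next
  case (scale a f)
  then have "f \<in> poly_space" using span_subset_poly_space[OF S] by auto
  then show ?case using \<phi> scale.IH unfolding linear_functional_def by simp
qed (rule vanish)

lemma poly_deg_le_mult_z:
  assumes "f \<in> poly_deg_le d" shows "(\<lambda>z. z * f z) \<in> poly_deg_le (d + 1)"
  using assms unfolding poly_deg_le_eq_span[of d]
proof (induction rule: span_pointwise_induct)
  case (base f)
  then obtain i j where f: "f = zmon (i, j)" "int (i + j) \<le> d" by auto
  then have "(\<lambda>z. z * f z) = zmon (Suc i, j)" by (auto simp: zmon_apply mult.assoc)
  then show ?case using f(2) unfolding poly_deg_le_eq_span by (auto intro!: fs.span_base imageI)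
qed (auto simp: distrib_left mult.left_commute intro: poly_deg_le_pw)

lemma poly_deg_le_cnj:
  assumes "f \<in> poly_deg_le d" shows "(\<lambda>z. cnj (f z)) \<in> poly_deg_le d"
  using assms unfolding poly_deg_le_eq_span[of d]
proof (induction rule: span_pointwise_induct)
  case (base f)
  then obtain i j where f: "f = zmon (i, j)" "int (i + j) \<le> d" by auto
  then have "(\<lambda>z. cnj (f z)) = zmon (j, i)" by (auto simp: zmon_apply mult.commute)
  then show ?case using f(2) by (auto intro!: fs.span_base imageI simp: add.commute)
qed (auto intro: span_pw)

lemma poly_deg_le_mult_cnj:
  assumes "f \<in> poly_deg_le d" shows "(\<lambda>z. cnj z * f z) \<in> poly_deg_le (d + 1)"
  using poly_deg_le_cnj[OF poly_deg_le_mult_z[OF poly_deg_le_cnj[OF assms]]] by simp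

lemma poly_space_cnj: "f \<in> poly_space \<Longrightarrow> (\<lambda>z. cnj (f z)) \<in> poly_space"
  unfolding poly_space_def using poly_deg_le_cnj by blast

lemma poly_space_mult_z: "f \<in> poly_space \<Longrightarrow> (\<lambda>z. z * f z) \<in> poly_space"
  unfolding poly_space_def using poly_deg_le_mult_z by blast

lemma poly_space_mult_cnj: "f \<in> poly_space \<Longrightarrow> (\<lambda>z. cnj z * f z) \<in> poly_space"
  unfolding poly_space_def using poly_deg_le_mult_cnj by blast

lemma poly_space_mult:
  assumes "f \<in> poly_space" "g \<in> poly_space" shows "(\<lambda>z. f z * g z) \<in> poly_space"
proof -
  have mon: "(\<lambda>z. zmon (i, j) z * g z) \<in> poly_space" for i j
  proof (induction i)
    case 0
    show ?case
    proof (induction j)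
      case 0
      then show ?case using assms(2) by (simp add: zmon_apply)
    next
      case (Suc j)
      from poly_space_mult_cnj[OF this] show ?case by (simp add: zmon_apply mult.assoc)
    qed
  next
    case (Suc i)
    from poly_space_mult_z[OF this] show ?case by (simp add: zmon_apply mult.assoc)
  qed
  show ?thesis using assms(1) unfolding poly_space_eq_span
  proof (induction rule: span_pointwise_induct)
    case (base f)
    then show ?case using mon unfolding poly_space_eq_span by auto
  qed (auto simp: distrib_right mult.assoc intro: span_pw)
qed

text \<open>
These are points of the unit circle; the numbers \<open>w = 1 + i s\<close> with \<open>s\<close> real already give different ratios.
\<close>

lemma infinite_unit_ratios: "infinite {w / cnj w | w. w \<noteq> 0}"
proof -
  let ?f = "\<lambda>s :: real. Complex 1 s / cnj (Complex 1 s)"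
  have ne: "Complex 1 s \<noteq> 0" "cnj (Complex 1 s) \<noteq> 0" for s by (auto simp: complex_eq_iff)
  have "inj ?f"
  proof (rule injI)
    fix s t assume "?f s = ?f t"
    then have "Complex 1 s * cnj (Complex 1 t) = Complex 1 t * cnj (Complex 1 s)"
      using frac_eq_eq[OF ne(2)[of s] ne(2)[of t]] by blast
    then show "s = t" by (simp add: complex_eq_iff)
  qed
  then have "infinite (range ?f)" using infinite_UNIV_char_0 finite_imageD by blast
  moreover have "range ?f \<subseteq> {w / cnj w | w. w \<noteq> 0}" using ne by blast
  ultimately show ?thesis using finite_subset by blast
qed

text \<open>
On a line through the origin, \<open>z = t * w\<close> with \<open>t\<close> real, the sum is a polynomial in \<open>t\<close>, so each of its
homogeneous parts vanishes at \<open>w\<close>. Divided by \<open>cnj w ^ d\<close>, the part of degree \<open>d\<close> is a polynomial in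
\<open>w / cnj w\<close>, which takes infinitely many values.
\<close>

lemma zmon_coeffs_zero:
  assumes fin: "finite S" and zero: "\<And>z. (\<Sum>p\<in>S. c p * zmon p z) = 0" and p0: "p0 \<in> S"
  shows "c p0 = 0"
proof -
  define d where "d = fst p0 + snd p0"
  have hom: "(\<Sum>p\<in>S. if fst p + snd p = d then c p * zmon p w else 0) = 0" for w
  proof -
    define P where "P = (\<Sum>p\<in>S. Polynomial.monom (c p * zmon p w) (fst p + snd p))"
    have "poly P (of_real t) = 0" for t
    proof -
      have "poly P (of_real t) = (\<Sum>p\<in>S. c p * zmon p (of_real t * w))"
        unfolding P_def poly_sum
        by (intro sum.cong) (auto simp: poly_monom zmon_def power_mult_distrib power_add)
      then show ?thesis using zero by simp
    qed
    then have "range (of_real :: real \<Rightarrow> complex) \<subseteq> {x. poly P x = 0}" by auto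
    moreover have "infinite (range (of_real :: real \<Rightarrow> complex))"
      using finite_imageD[of "of_real :: real \<Rightarrow> complex" UNIV] infinite_UNIV_char_0
      by (auto simp: inj_on_def)
    ultimately have "P = 0" using poly_roots_finite[of P] finite_subset by blast
    then have "coeff P d = 0" by simp
    then show ?thesis by (simp add: P_def coeff_sum if_distrib cong: if_cong)
  qed
  \<comment> \<open>the homogeneous part of degree \<open>d\<close>, divided by \<open>cnj w ^ d\<close>, as a polynomial in \<open>w / cnj w\<close>\<close>
  define R where "R = (\<Sum>p\<in>S. if fst p + snd p = d then Polynomial.monom (c p) (fst p) else 0)"
  have "poly R (w / cnj w) = 0" if "w \<noteq> 0" for w
  proof -
    have "poly R (w / cnj w) = (\<Sum>p\<in>S. if fst p + snd p = d then c p * zmon p w else 0) / cnj w ^ d"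
      unfolding R_def poly_sum sum_divide_distrib
      using that by (intro sum.cong) (auto simp: poly_monom zmon_def power_divide power_add)
    then show ?thesis using hom by simp
  qed
  then have "{w / cnj w | w. w \<noteq> 0} \<subseteq> {x. poly R x = 0}" by auto
  then have "R = 0" using poly_roots_finite[of R] infinite_unit_ratios finite_subset by blast
  then have "0 = coeff R (fst p0)" by simp
  also have "\<dots> = (\<Sum>p\<in>S. if p = p0 then c p else 0)"
    unfolding R_def coeff_sum by (intro sum.cong) (auto simp: d_def prod_eq_iff)
  also have "\<dots> = c p0" using fin p0 by simp
  finally show ?thesis by simp
qed

lemma inj_zmon: "inj zmon"
proof (rule injI, rule ccontr)
  fix p q assume eq: "zmon p = zmon q" and ne: "p \<noteq> q"
  have "(\<Sum>r\<in>{p, q}. (if r = p then 1 else -1) * zmon r z) = 0" for z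
    using eq ne by simp
  from zmon_coeffs_zero[OF _ this, of p] show False by simp
qed

lemma independent_zmon: "fs.independent (range zmon)"
proof -
  have "u v = 0"
    if t: "t \<subseteq> range zmon" "finite t" and s: "(\<Sum>v\<in>t. (\<lambda>z. u v * v z)) = 0" and v: "v \<in> t" for t u v
  proof -
    from t obtain S where S: "t = zmon ` S" "finite S"
      by (metis finite_subset_image)
    have "(\<Sum>p\<in>S. u (zmon p) * zmon p z) = 0" for z
    proof -
      have "(\<Sum>p\<in>S. u (zmon p) * zmon p z) = (\<Sum>v\<in>t. u v * v z)"
        unfolding S(1) using inj_zmon by (subst sum.reindex) (auto simp: inj_on_def)
      then show ?thesis using fun_cong[OF s, of z] by (simp add: sum_fun_apply)
    qed
    from zmon_coeffs_zero[OF S(2) this] v S(1) show ?thesis by auto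
  qed
  then show ?thesis unfolding fs.independent_explicit_finite_subsets by blast
qed

definition zcoeff :: "(complex \<Rightarrow> complex) \<Rightarrow> nat \<times> nat \<Rightarrow> complex" where
  "zcoeff f p = fs.representation (range zmon) f (zmon p)"

lemma zcoeff_zmon: "zcoeff (zmon p) q = (if p = q then 1 else 0)"
  unfolding zcoeff_def by (subst fs.representation_basis[OF independent_zmon])
    (auto simp: inj_eq[OF inj_zmon])

lemma zcoeff_zero: "zcoeff (\<lambda>z. 0) p = 0"
  unfolding zcoeff_def using fs.representation_zero by (simp add: zero_fun_def)

lemma zcoeff_add:
  assumes "f \<in> poly_space" "g \<in> poly_space"
  shows "zcoeff (\<lambda>z. f z + g z) p = zcoeff f p + zcoeff g p"
  using assms fs.representation_add[OF independent_zmon, of g f]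
  unfolding zcoeff_def poly_space_eq_span by (simp add: plus_fun_def)

lemma zcoeff_scale:
  assumes "f \<in> poly_space"
  shows "zcoeff (\<lambda>z. a * f z) p = a * zcoeff f p"
  using assms fs.representation_scale[OF independent_zmon, of f a]
  unfolding zcoeff_def poly_space_eq_span by simp

lemma zcoeff_mult_z:
  assumes "f \<in> poly_space"
  shows "zcoeff (\<lambda>z. z * f z) (i, j) = (if i = 0 then 0 else zcoeff f (i - 1, j))"
  using assms unfolding poly_space_eq_span
proof (induction rule: span_pointwise_induct)
  case (add f g)
  then show ?case unfolding poly_space_eq_span[symmetric]
    by (simp add: distrib_left zcoeff_add poly_space_mult_z)
next
  case (scale a f)
  then show ?case unfolding poly_space_eq_span[symmetric]
    by (simp add: mult.left_commute[of _ a] zcoeff_scale poly_space_mult_z)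
next
  case (base f)
  then obtain k l where "f = zmon (k, l)" by auto
  moreover have "(\<lambda>z. z * zmon (k, l) z) = zmon (Suc k, l)"
    by (simp add: zmon_apply fun_eq_iff)
  ultimately show ?case by (auto simp: zcoeff_zmon)
qed (auto simp: zcoeff_zero)

lemma zcoeff_mult_cnj:
  assumes "f \<in> poly_space"
  shows "zcoeff (\<lambda>z. cnj z * f z) (i, j) = (if j = 0 then 0 else zcoeff f (i, j - 1))"
  using assms unfolding poly_space_eq_span
proof (induction rule: span_pointwise_induct)
  case (add f g)
  then show ?case unfolding poly_space_eq_span[symmetric]
    by (simp add: distrib_left zcoeff_add poly_space_mult_cnj)
next
  case (scale a f)
  then show ?case unfolding poly_space_eq_span[symmetric]
    by (simp add: mult.left_commute[of _ a] zcoeff_scale poly_space_mult_cnj)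
next
  case (base f)
  then obtain k l where "f = zmon (k, l)" by auto
  moreover have "(\<lambda>z. cnj z * zmon (k, l) z) = zmon (k, Suc l)"
    by (simp add: zmon_apply fun_eq_iff)
  ultimately show ?case by (auto simp: zcoeff_zmon)
qed (auto simp: zcoeff_zero)

lemma poly_deg_le_iff_zcoeff:
  assumes "f \<in> poly_space"
  shows "f \<in> poly_deg_le d \<longleftrightarrow> (\<forall>i j. int (i + j) > d \<longrightarrow> zcoeff f (i, j) = 0)"
proof
  assume "f \<in> poly_deg_le d"
  then have "f \<in> fs.span (zmon ` {(i, j). int (i + j) \<le> d})" by (simp add: poly_deg_le_eq_span)
  then show "\<forall>i j. int (i + j) > d \<longrightarrow> zcoeff f (i, j) = 0"
  proof (induction rule: span_pointwise_induct)
    case (add f g)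
    then have "f \<in> poly_space" "g \<in> poly_space"
      using poly_deg_le_subset_poly_space[of d] by (auto simp: poly_deg_le_eq_span)
    then show ?case using add by (simp add: zcoeff_add)
  next
    case (scale a f)
    then have "f \<in> poly_space"
      using poly_deg_le_subset_poly_space[of d] by (auto simp: poly_deg_le_eq_span)
    then show ?case using scale by (simp add: zcoeff_scale)
  qed (auto simp: zcoeff_zero zcoeff_zmon)
next
  assume zero: "\<forall>i j. int (i + j) > d \<longrightarrow> zcoeff f (i, j) = 0"
  let ?r = "fs.representation (range zmon) f"
  have "b \<in> poly_deg_le d" if "?r b \<noteq> 0" for b
  proof -
    from fs.representation_ne_zero[OF that] obtain i j where b: "b = zmon (i, j)" by auto
    then have "int (i + j) \<le> d" using that zero by (force simp: zcoeff_def)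
    then show ?thesis using b unfolding poly_deg_le_eq_span by (auto intro!: fs.span_base imageI)
  qed
  then have "(\<Sum>b | ?r b \<noteq> 0. (\<lambda>z. ?r b * b z)) \<in> poly_deg_le d"
    unfolding poly_deg_le_eq_span by (intro fs.span_sum fs.span_scale) simp
  then show "f \<in> poly_deg_le d"
    using fs.sum_nonzero_representation_eq[OF independent_zmon, of f] assms
    by (simp add: poly_space_eq_span)
qed

text \<open>
If \<open>g i\<close> is the coefficient of \<open>z ^ i * cnj z ^ (n - i)\<close> in \<open>q\<close>, then the coefficient of
\<open>z ^ i * cnj z ^ (n + 1 - i)\<close> in the product is \<open>a * g (i - 1) + b * g i\<close>. As these all vanish and \<open>b \<noteq> 0\<close>,
the \<open>g i\<close> vanish one after the other, starting from \<open>i = 0\<close>.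
\<close>

lemma degree_drop:
  assumes q: "q \<in> poly_deg_le (int n)" and b: "b \<noteq> 0"
    and lq: "(\<lambda>z. (a * z + b * cnj z) * q z) \<in> poly_deg_le (int n)"
  shows "q \<in> poly_deg_le (int n - 1)"
proof -
  have qP: "q \<in> poly_space" using q poly_deg_le_subset_poly_space by blast
  have zero: "zcoeff q (i, j) = 0" if "int (i + j) > int n" for i j
    using q that by (simp add: poly_deg_le_iff_zcoeff[OF qP])
  have rec: "a * (if i = 0 then 0 else zcoeff q (i - 1, j)) +
      b * (if j = 0 then 0 else zcoeff q (i, j - 1)) = 0" if "i + j = Suc n" for i j
  proof -
    have "zcoeff (\<lambda>z. (a * z + b * cnj z) * q z) (i, j) = 0"
      using lq that poly_deg_le_iff_zcoeff[of "\<lambda>z. (a * z + b * cnj z) * q z" "int n"]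
        poly_deg_le_subset_poly_space[of "int n"] by auto
    also have "(\<lambda>z. (a * z + b * cnj z) * q z) = (\<lambda>z. a * (z * q z) + b * (cnj z * q z))"
      by (simp add: algebra_simps)
    finally show ?thesis using qP
      by (simp add: zcoeff_add zcoeff_scale zcoeff_mult_z zcoeff_mult_cnj poly_space_pw
          poly_space_mult_z poly_space_mult_cnj)
  qed
  have "zcoeff q (i, n - i) = 0" if "i \<le> n" for i
    using that
  proof (induction i)
    case 0
    then show ?case using rec[of 0 "Suc n"] b by simp
  next
    case (Suc i)
    then have "Suc n - Suc i - 1 = n - Suc i" "Suc n - Suc i = n - i" "Suc n - Suc i \<noteq> 0" by auto
    then show ?case using rec[of "Suc i" "Suc n - Suc i"] Suc b by simp
  qed
  then have "zcoeff q (i, j) = 0" if "i + j = n" for i j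
    using that by (metis add_diff_cancel_left' le_add1)
  then have "zcoeff q (i, j) = 0" if "int (i + j) > int n - 1" for i j
    using zero[of i j] that by (cases "i + j = n") auto
  then show ?thesis by (simp add: poly_deg_le_iff_zcoeff[OF qP])
qed

lemma poly_deg_le_Suc_subset_span:
  "poly_deg_le (int (Suc n)) \<subseteq> fs.span (poly_deg_le (int n) \<union>
     (\<lambda>f z. z * f z) ` poly_deg_le (int n) \<union> (\<lambda>f z. cnj z * f z) ` poly_deg_le (int n))"
    (is "_ \<subseteq> fs.span ?S")
proof -
  have mon: "zmon (i, j) \<in> poly_deg_le (int n)" if "i + j \<le> n" for i j
    unfolding poly_deg_le_eq_span using that by (auto intro!: fs.span_base imageI)
  have "zmon (i, j) \<in> ?S" if "i + j \<le> Suc n" for i j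
  proof (cases i)
    case (Suc i')
    have "zmon (i, j) = (\<lambda>z. z * zmon (i', j) z)" using Suc by (simp add: zmon_apply fun_eq_iff)
    then have "zmon (i, j) \<in> (\<lambda>f z. z * f z) ` poly_deg_le (int n)"
      using mon[of i' j] that Suc by (intro image_eqI) auto
    then show ?thesis by simp
  next
    case 0
    show ?thesis
    proof (cases j)
      case (Suc j')
      have "zmon (i, j) = (\<lambda>z. cnj z * zmon (i, j') z)" using Suc by (simp add: zmon_apply fun_eq_iff)
      then have "zmon (i, j) \<in> (\<lambda>f z. cnj z * f z) ` poly_deg_le (int n)"
        using mon[of i j'] that Suc by (intro image_eqI) auto
      then show ?thesis by simp
    qed (use mon[of i j] 0 in simp)
  qed
  then have "zmon ` {(i, j). int (i + j) \<le> int (Suc n)} \<subseteq> ?S"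
    by (intro image_subsetI) (metis (no_types, lifting) mem_Collect_eq case_prodE of_nat_le_iff)
  then show ?thesis unfolding poly_deg_le_eq_span[of "int (Suc n)"] by (rule fs.span_mono)
qed

text \<open>
Among the polynomials of degree at most \<open>n\<close> there are as many independent monomials as there are
indices \<open>i + j \<le> n\<close>. A spanning family with the same index set therefore repeats no element
and admits no relation.
\<close>

lemma graded_spanning_imp_basis:
  fixes q :: "nat \<times> nat \<Rightarrow> complex \<Rightarrow> complex"
  assumes span: "\<And>n :: nat. fs.span (q ` {(i, j). i + j \<le> n}) = poly_deg_le (int n)"
  shows "inj q" and "fs.independent (range q)"
proof -
  define I where "I n = {(i :: nat, j). i + j \<le> n}" for n :: nat
  have I: "I n = {(i, j). int (i + j) \<le> int n}" for n unfolding I_def by auto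
  have finI: "finite (I n)" for n unfolding I by (rule finite_degree_le)
  have span_eq: "fs.span (q ` I n) = fs.span (zmon ` I n)" for n
    using span[of n] unfolding poly_deg_le_eq_span I[symmetric] I_def[symmetric] .
  have card_I: "card (I n) \<le> card B" if "fs.span B = fs.span (q ` I n)" "finite B" for B n
  proof -
    have "fs.independent (zmon ` I n)"
      by (rule fs.independent_mono[OF independent_zmon]) auto
    moreover have "zmon ` I n \<subseteq> fs.span B"
      using that(1) span_eq[of n] fs.span_superset[of "zmon ` I n"] by simp
    ultimately have "card (zmon ` I n) \<le> card B"
      using fs.independent_span_bound[OF that(2)] by blast
    then show ?thesis using card_image[OF inj_on_subset[OF inj_zmon]] by simp
  qed
  have card_q: "card (q ` I n) = card (I n)" for n
    by (intro antisym card_image_le finI card_I[OF refl] finite_imageI)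
  have inj: "inj_on q (I n)" for n
    using card_q by (intro eq_card_imp_inj_on finI)
  show "inj q"
  proof (rule injI)
    fix p p' assume "q p = q p'"
    moreover have "p \<in> I (fst p + snd p + fst p' + snd p')" "p' \<in> I (fst p + snd p + fst p' + snd p')"
      by (auto simp: I_def case_prod_beta)
    ultimately show "p = p'" using inj by (meson inj_onD)
  qed
  have indep: "fs.independent (q ` I n)" for n
  proof
    assume "fs.dependent (q ` I n)"
    then obtain a where a: "a \<in> q ` I n" "a \<in> fs.span (q ` I n - {a})"
      unfolding fs.dependent_def by blast
    have "fs.span (q ` I n - {a}) = fs.span (q ` I n)"
      using fs.span_redundant[OF a(2)] a(1) by (simp add: insert_absorb)
    then have "card (I n) \<le> card (q ` I n - {a})" using card_I finI by simp
    also have "\<dots> < card (q ` I n)" by (rule card_Diff1_less[OF finite_imageI[OF finI] a(1)])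
    finally show False using card_q by simp
  qed
  have "range q = \<Union>(range (\<lambda>n. q ` I n))" by (auto simp: I_def)
  also have "fs.independent \<dots>"
  proof (rule fs.independent_Union_directed)
    fix c d assume "c \<in> range (\<lambda>n. q ` I n)" "d \<in> range (\<lambda>n. q ` I n)"
    then obtain m n where "c = q ` I m" "d = q ` I n" by auto
    moreover have "I m \<subseteq> I n \<or> I n \<subseteq> I m" unfolding I_def by (cases "m \<le> n") auto
    ultimately show "c \<subseteq> d \<or> d \<subseteq> c" by blast
  qed (use indep in auto)
  finally show "fs.independent (range q)" .
qed

section \<open>Full rank and the entries of the coefficient matrices\<close>

text \<open>
The rank is the dimension of the span of the set of columns, so repeated columns, which that set does
not show, have to be excluded separately.
\<close>

lemma full_column_rank_iff:
  fixes A :: "complex mat"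
  assumes A: "A \<in> carrier_mat nr nc"
  shows "vec_space.rank nr A = nc \<longleftrightarrow>
    (\<forall>v \<in> carrier_vec nc. A *\<^sub>v v = 0\<^sub>v nr \<longrightarrow> v = 0\<^sub>v nc)"
proof -
  interpret vec_space "TYPE(complex)" nr .
  have cols: "set (cols A) \<subseteq> carrier_vec nr" using cols_dim A by blast
  show ?thesis
  proof (intro iffI ballI impI)
    fix v assume r: "rank A = nc" and v: "v \<in> carrier_vec nc" "A *\<^sub>v v = 0\<^sub>v nr"
    have "distinct (cols A)"
    proof (rule ccontr)
      assume nd: "\<not> distinct (cols A)"
      obtain S where S: "maximal S (\<lambda>T. T \<subseteq> set (cols A) \<and> lin_indpt T)"
        using maximal_exists[of "(\<lambda>T. T \<subseteq> set (cols A) \<and> lin_indpt T)" "card (set (cols A))" "{}"]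
        by (meson List.finite_set card_mono empty_iff empty_subsetI finite_lin_indpt2 rev_finite_subset)
      then have "card S \<le> card (set (cols A))" by (simp add: card_mono maximal_def)
      also have "\<dots> < length (cols A)"
        using nd card_distinct card_length le_neq_implies_less by blast
      finally show False using rank_card_indpt[OF A S] r A by simp
    qed
    then show "v = 0\<^sub>v nc"
      using lin_depI[OF A v(1) _ v(2)] full_rank_lin_indpt[OF A r] by blast
  next
    assume inj: "\<forall>v \<in> carrier_vec nc. A *\<^sub>v v = 0\<^sub>v nr \<longrightarrow> v = 0\<^sub>v nc"
    have d: "distinct (cols A)"
    proof (rule ccontr)
      assume "\<not> distinct (cols A)"
      then obtain i j where ij: "i < nc" "j < nc" "i \<noteq> j" "col A i = col A j"
        using A by (auto simp: distinct_conv_nth)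
      let ?v = "unit_vec nc i - unit_vec nc j :: complex vec"
      have "A $$ (a, i) = A $$ (a, j)" if "a < nr" for a
        using arg_cong[OF ij(4), of "\<lambda>v. v $ a"] that ij(1,2) A by simp
      then have "A *\<^sub>v ?v = 0\<^sub>v nr"
        using A ij(1,2) by (intro eq_vecI) (auto simp: mult_minus_distrib_mat_vec)
      then have "?v = 0\<^sub>v nc" using inj by simp
      then have "?v $ i = 0" using ij by simp
      then show False using ij by simp
    qed
    have "lin_indpt (set (cols A))" using lin_depE[OF A _ d] inj by blast
    then show "rank A = nc" by (rule lin_indpt_full_rank[OF A d])
  qed
qed

text \<open>
With \<open>B\<close> the conjugate transpose of \<open>A\<close>, the Gram matrix \<open>B * A\<close> has the same kernel as \<open>A\<close>, hence is
invertible, and its inverse times \<open>B\<close> is a left inverse of \<open>A\<close>.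
\<close>

lemma injective_imp_left_inverse:
  fixes A :: "complex mat"
  assumes A: "A \<in> carrier_mat nr nc"
    and inj: "\<And>v. v \<in> carrier_vec nc \<Longrightarrow> A *\<^sub>v v = 0\<^sub>v nr \<Longrightarrow> v = 0\<^sub>v nc"
  shows "\<exists>D \<in> carrier_mat nc nr. D * A = 1\<^sub>m nc"
proof -
  define B where "B = transpose_mat (map_mat cnj A)"
  have B: "B \<in> carrier_mat nc nr" and cA: "map_mat cnj A \<in> carrier_mat nr nc"
    using A by (auto simp: B_def)
  have G: "B * A \<in> carrier_mat nc nc" using A B by simp
  have "det (B * A) \<noteq> 0"
  proof
    assume "det (B * A) = 0"
    then obtain v where v: "v \<in> carrier_vec nc" "v \<noteq> 0\<^sub>v nc" "B * A *\<^sub>v v = 0\<^sub>v nc"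
      using det_0_iff_vec_prod_zero_field[OF G] by auto
    have Av: "A *\<^sub>v v \<in> carrier_vec nr" using A v by simp
    have "map_mat cnj A *\<^sub>v conjugate v = conjugate (A *\<^sub>v v)"
      using A v(1) by (intro eq_vecI) (auto simp: scalar_prod_def conjugate_complex_def)
    then have "(A *\<^sub>v v) \<bullet>c (A *\<^sub>v v) = (B *\<^sub>v (A *\<^sub>v v)) \<bullet>c v"
      using transpose_vec_mult_scalar[OF cA, of "conjugate v" "A *\<^sub>v v"] v(1) Av by (simp add: B_def)
    also have "\<dots> = 0" using v A B by (simp flip: assoc_mult_mat_vec)
    finally have "A *\<^sub>v v = 0\<^sub>v nr" using Av by simp
    then show False using inj v by blast
  qed
  then obtain C where C: "C \<in> carrier_mat nc nc" "C * (B * A) = 1\<^sub>m nc"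
    using det_non_zero_imp_unit[OF G, of "()"] by (auto simp: Units_def ring_mat_def)
  then show ?thesis using A B
    by (intro bexI[of _ "C * B"]) (auto simp: assoc_mult_mat[OF C(1) B A])
qed

text \<open>
A left inverse of the transpose is the transpose of a right inverse, so the columns span everything.
\<close>

lemma full_row_rank:
  fixes A :: "complex mat"
  assumes A: "A \<in> carrier_mat nr nc"
    and inj: "\<And>y. y \<in> carrier_vec nr \<Longrightarrow> transpose_mat A *\<^sub>v y = 0\<^sub>v nc \<Longrightarrow> y = 0\<^sub>v nr"
  shows "vec_space.rank nr A = nr"
proof -
  interpret vec_space "TYPE(complex)" nr .
  obtain D where D: "D \<in> carrier_mat nr nc" "D * transpose_mat A = 1\<^sub>m nr"
    using injective_imp_left_inverse[of "transpose_mat A" nc nr] A inj by auto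
  then have AD: "A * transpose_mat D = 1\<^sub>m nr"
    using A transpose_mult[of D nr nc "transpose_mat A" nr] by simp
  have "col_space A = carrier_vec nr"
  proof -
    have "\<exists>x \<in> carrier_vec nc. A *\<^sub>v x = y" if y: "y \<in> carrier_vec nr" for y
      using y A D AD by (intro bexI[of _ "transpose_mat D *\<^sub>v y"])
        (auto simp flip: assoc_mult_mat_vec)
    then show ?thesis using A by (auto simp: col_space_eq[OF A])
  qed
  then have "span_vs (set (cols A)) = V" unfolding col_space_def by simp
  then show ?thesis unfolding rank_def using dim_is_n by simp
qed

lemma mat_vee_carrier: "M \<in> carrier_mat nr nc \<Longrightarrow> mat_vee M \<in> carrier_mat nr nc"
  by (auto simp: mat_vee_def backward_id_def)

lemma mat_vee_index:
  assumes M: "M \<in> carrier_mat nr nc" and i: "i < nr" and j: "j < nc"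
  shows "mat_vee M $$ (i, j) = cnj (M $$ (nr - 1 - i, nc - 1 - j))"
proof -
  have flip: "(i' + j' + 1 = n) \<longleftrightarrow> (j' = n - 1 - i')" if "i' < n" for i' j' n :: nat
    using that by auto
  have left: "(backward_id nr * map_mat cnj M) $$ (i, l) = cnj (M $$ (nr - 1 - i, l))"
    if l: "l < nc" for l
  proof -
    have "(backward_id nr * map_mat cnj M) $$ (i, l) =
        (\<Sum>k\<in>{0..<nr}. (if k = nr - 1 - i then 1 else 0) * cnj (M $$ (k, l)))"
      using M i l by (auto simp: backward_id_def scalar_prod_def flip[OF i] intro!: sum.cong)
    also have "\<dots> = (\<Sum>k\<in>{0..<nr}. if k = nr - 1 - i then cnj (M $$ (k, l)) else 0)"
      by (intro sum.cong) auto
    also have "\<dots> = cnj (M $$ (nr - 1 - i, l))" using i by (subst sum.delta) auto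
    finally show ?thesis .
  qed
  have "mat_vee M $$ (i, j) =
      (\<Sum>l\<in>{0..<nc}. (backward_id nr * map_mat cnj M) $$ (i, l) * backward_id nc $$ (l, j))"
    using M i j by (auto simp: mat_vee_def backward_id_def scalar_prod_def intro!: sum.cong)
  also have "\<dots> = (\<Sum>l\<in>{0..<nc}. if l = nc - 1 - j then cnj (M $$ (nr - 1 - i, l)) else 0)"
  proof (intro sum.cong refl)
    fix l assume l: "l \<in> {0..<nc}"
    then have "backward_id nc $$ (l, j) = (if l = nc - 1 - j then 1 else 0)"
      using j by (auto simp: backward_id_def)
    then show "(backward_id nr * map_mat cnj M) $$ (i, l) * backward_id nc $$ (l, j) =
        (if l = nc - 1 - j then cnj (M $$ (nr - 1 - i, l)) else 0)"
      using left[of l] l by simp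
  qed
  also have "\<dots> = cnj (M $$ (nr - 1 - i, nc - 1 - j))" using j by (subst sum.delta) auto
  finally show ?thesis .
qed

lemma mat_adjoint_index:
  fixes A :: "complex mat"
  assumes A: "A \<in> carrier_mat nr nc" and "i < nc" "j < nr"
  shows "mat_adjoint A $$ (i, j) = cnj (A $$ (j, i))"
  using assms by (auto simp: mat_adjoint_def mat_of_rows_def)

lemma mat_adjoint_carrier:
  fixes A :: "complex mat"
  shows "A \<in> carrier_mat nr nc \<Longrightarrow> mat_adjoint A \<in> carrier_mat nc nr"
  by (auto simp: mat_adjoint_def)

lemma mult_mat_vec_index_atMost:
  assumes "A \<in> carrier_mat nr (Suc m)" "k < nr"
  shows "(A *\<^sub>v vec (Suc m) f) $ k = (\<Sum>l\<le>m. A $$ (k, l) * f l)"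
  using assms by (auto simp: scalar_prod_def atLeast0LessThan lessThan_Suc_atMost intro!: sum.cong)

text \<open>
The entry of \<open>mat_vee (mat_adjoint (\<alpha> (n - 1)))\<close> at \<open>(k, l)\<close> is an unconjugated entry of \<open>\<alpha> (n - 1)\<close>: the
two conjugations cancel, and only the transposition and the two reversals remain.
\<close>

lemma three_term_relation_iff:
  assumes \<alpha>: "\<And>n. \<alpha> n \<in> carrier_mat (n + 1) (n + 2)" and \<beta>: "\<beta> n \<in> carrier_mat (n + 1) (n + 1)"
  shows "z \<cdot>\<^sub>v Qvec Q n z =
          \<alpha> n *\<^sub>v Qvec Q (n + 1) z + \<beta> n *\<^sub>v Qvec Q n z +
          (if n = 0 then 0\<^sub>v (n + 1)
           else mat_vee (mat_adjoint (\<alpha> (n - 1))) *\<^sub>v Qvec Q (n - 1) z) \<longleftrightarrow>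
    (\<forall>k\<le>n. z * Q k n z = (\<Sum>l\<le>Suc n. \<alpha> n $$ (k, l) * Q l (Suc n) z) +
      (\<Sum>l\<le>n. \<beta> n $$ (k, l) * Q l n z) +
      (if n = 0 then 0 else \<Sum>l\<le>n - 1. \<alpha> (n - 1) $$ (n - 1 - l, n - k) * Q l (n - 1) z))"
    (is "?v = ?w + ?x + ?y \<longleftrightarrow> (\<forall>k\<le>n. ?c k)")
proof -
  have \<alpha>': "\<alpha> n \<in> carrier_mat (Suc n) (Suc (Suc n))" and \<beta>': "\<beta> n \<in> carrier_mat (Suc n) (Suc n)"
    using \<alpha>[of n] \<beta> by auto
  have low: "?y \<in> carrier_vec (n + 1) \<and> (\<forall>k\<le>n. ?y $ k =
      (if n = 0 then 0 else \<Sum>l\<le>n - 1. \<alpha> (n - 1) $$ (n - 1 - l, n - k) * Q l (n - 1) z))"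
  proof (cases n)
    case (Suc m)
    have adj: "mat_adjoint (\<alpha> m) \<in> carrier_mat (m + 2) (m + 1)"
      by (rule mat_adjoint_carrier[OF \<alpha>])
    then have V: "mat_vee (mat_adjoint (\<alpha> m)) \<in> carrier_mat (Suc (Suc m)) (Suc m)"
      using mat_vee_carrier[OF adj] by simp
    have "mat_vee (mat_adjoint (\<alpha> m)) $$ (k, l) = \<alpha> m $$ (m - l, Suc m - k)"
      if "k \<le> Suc m" "l \<le> m" for k l
      using that by (simp add: mat_vee_index[OF adj] mat_adjoint_index[OF \<alpha>])
    then have "(mat_vee (mat_adjoint (\<alpha> m)) *\<^sub>v Qvec Q m z) $ k =
        (\<Sum>l\<le>m. \<alpha> m $$ (m - l, Suc m - k) * Q l m z)" if "k \<le> Suc m" for k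
      using mult_mat_vec_index_atMost[OF V, of k "\<lambda>l. Q l m z"] that by (simp add: Qvec_def)
    moreover have "?y = mat_vee (mat_adjoint (\<alpha> m)) *\<^sub>v Qvec Q m z" using Suc by simp
    moreover have "mat_vee (mat_adjoint (\<alpha> m)) *\<^sub>v Qvec Q m z \<in> carrier_vec (Suc (Suc m))"
      using V by (rule mult_mat_vec_carrier) (simp add: Qvec_def)
    ultimately show ?thesis using Suc by simp
  qed auto
  then have dim: "dim_vec ?v = n + 1" "dim_vec (?w + ?x + ?y) = n + 1"
    by (auto simp: Qvec_def)
  have "?v = ?w + ?x + ?y \<longleftrightarrow> (\<forall>k<n+1. ?v $ k = (?w + ?x + ?y) $ k)"
    using dim by (metis eq_vecI)
  also have "\<dots> \<longleftrightarrow> (\<forall>k\<le>n. ?c k)"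
  proof -
    have "?v $ k = (?w + ?x + ?y) $ k \<longleftrightarrow> ?c k" if k: "k \<le> n" for k
    proof -
      have "?v $ k = z * Q k n z" using k by (simp add: Qvec_def)
      moreover have "(?w + ?x + ?y) $ k = ?w $ k + ?x $ k + ?y $ k"
      proof -
        have "dim_vec ?y = n + 1" "dim_vec ?x = n + 1" using low \<beta> by auto
        then show ?thesis using k by (simp only: index_add_vec add_increasing2 less_Suc_eq_le flip: Suc_eq_plus1)
      qed
      moreover have "?w $ k = (\<Sum>l\<le>Suc n. \<alpha> n $$ (k, l) * Q l (Suc n) z)"
        using mult_mat_vec_index_atMost[OF \<alpha>', of k "\<lambda>l. Q l (Suc n) z"] k by (simp add: Qvec_def)
      moreover have "?x $ k = (\<Sum>l\<le>n. \<beta> n $$ (k, l) * Q l n z)"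
        using mult_mat_vec_index_atMost[OF \<beta>', of k "\<lambda>l. Q l n z"] k by (simp add: Qvec_def)
      ultimately show ?thesis using low k by simp
    qed
    then show ?thesis by (auto simp: less_Suc_eq_le)
  qed
  finally show ?thesis .
qed

lemma stacked_mult_eq_0_iff:
  assumes \<alpha>: "\<alpha> \<in> carrier_mat (n + 1) (n + 2)"
  shows "(\<alpha> @\<^sub>r mat_vee \<alpha>) *\<^sub>v vec (n + 2) x = 0\<^sub>v (2 * (n + 1)) \<longleftrightarrow>
    (\<forall>k\<le>n. (\<Sum>l\<le>Suc n. \<alpha> $$ (k, l) * x l) = 0) \<and>
    (\<forall>k\<le>n. (\<Sum>l\<le>Suc n. cnj (\<alpha> $$ (n - k, Suc n - l)) * x l) = 0)"
proof -
  let ?x = "vec (Suc (Suc n)) x"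
  have \<alpha>': "\<alpha> \<in> carrier_mat (Suc n) (Suc (Suc n))" using \<alpha> by simp
  have V: "mat_vee \<alpha> \<in> carrier_mat (Suc n) (Suc (Suc n))" by (rule mat_vee_carrier[OF \<alpha>'])
  have zero: "0\<^sub>v (2 * (n + 1)) = 0\<^sub>v (Suc n) @\<^sub>v (0\<^sub>v (Suc n) :: complex vec)"
    by (intro eq_vecI) (auto simp: append_vec_def)
  have append: "(\<alpha> @\<^sub>r mat_vee \<alpha>) *\<^sub>v ?x = (\<alpha> *\<^sub>v ?x) @\<^sub>v (mat_vee \<alpha> *\<^sub>v ?x)"
    by (rule mat_mult_append[OF \<alpha>' V]) simp
  have carrier: "\<alpha> *\<^sub>v ?x \<in> carrier_vec (Suc n)"
    using \<alpha>' by (rule mult_mat_vec_carrier) simp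
  have "(\<alpha> @\<^sub>r mat_vee \<alpha>) *\<^sub>v ?x = 0\<^sub>v (2 * (n + 1)) \<longleftrightarrow>
      \<alpha> *\<^sub>v ?x = 0\<^sub>v (Suc n) \<and> mat_vee \<alpha> *\<^sub>v ?x = 0\<^sub>v (Suc n)"
    unfolding append zero by (rule append_vec_eq[OF carrier zero_carrier_vec])
  also have "\<dots> \<longleftrightarrow> (\<forall>k\<le>n. (\<alpha> *\<^sub>v ?x) $ k = 0) \<and> (\<forall>k\<le>n. (mat_vee \<alpha> *\<^sub>v ?x) $ k = 0)"
    using \<alpha>' V unfolding vec_eq_iff by (auto simp: less_Suc_eq_le simp del: index_mult_mat_vec)
  finally have iff: "(\<alpha> @\<^sub>r mat_vee \<alpha>) *\<^sub>v ?x = 0\<^sub>v (2 * (n + 1)) \<longleftrightarrow>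
    (\<forall>k\<le>n. (\<alpha> *\<^sub>v ?x) $ k = 0) \<and> (\<forall>k\<le>n. (mat_vee \<alpha> *\<^sub>v ?x) $ k = 0)" .
  have upper: "(\<alpha> *\<^sub>v ?x) $ k = (\<Sum>l\<le>Suc n. \<alpha> $$ (k, l) * x l)" if "k \<le> n" for k
    using that by (intro mult_mat_vec_index_atMost[OF \<alpha>']) simp
  have "(mat_vee \<alpha> *\<^sub>v ?x) $ k = (\<Sum>l\<le>Suc n. mat_vee \<alpha> $$ (k, l) * x l)" if "k \<le> n" for k
    using that by (intro mult_mat_vec_index_atMost[OF V]) simp
  also have "(\<Sum>l\<le>Suc n. mat_vee \<alpha> $$ (k, l) * x l) =
      (\<Sum>l\<le>Suc n. cnj (\<alpha> $$ (n - k, Suc n - l)) * x l)" if "k \<le> n" for k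
    using that by (intro sum.cong refl) (simp add: mat_vee_index[OF \<alpha>'])
  finally have lower: "(mat_vee \<alpha> *\<^sub>v ?x) $ k =
      (\<Sum>l\<le>Suc n. cnj (\<alpha> $$ (n - k, Suc n - l)) * x l)" if "k \<le> n" for k
    using that by blast
  show ?thesis using iff by (simp add: upper lower del: sum.atMost_Suc index_mult_mat_vec)
qed

text \<open>
The coefficients \<open>d\<close> and \<open>e\<close> are the left and right halves of a left inverse of the stacked matrix.
\<close>

lemma stacked_rank_imp_left_inverse:
  assumes \<alpha>: "\<alpha> \<in> carrier_mat (n + 1) (n + 2)"
    and rank: "vec_space.rank (2 * (n + 1)) (\<alpha> @\<^sub>r mat_vee \<alpha>) = n + 2"
  shows "\<exists>d e. \<forall>l\<le>Suc n. \<forall>m\<le>Suc n.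
    (\<Sum>k\<le>n. d l k * \<alpha> $$ (k, m) + e l k * cnj (\<alpha> $$ (n - k, Suc n - m))) = (if l = m then 1 else 0)"
proof -
  let ?M = "\<alpha> @\<^sub>r mat_vee \<alpha>"
  have V: "mat_vee \<alpha> \<in> carrier_mat (n + 1) (n + 2)" by (rule mat_vee_carrier[OF \<alpha>])
  have M: "?M \<in> carrier_mat (2 * (n + 1)) (n + 2)"
    using carrier_append_rows[OF \<alpha> V] by (simp add: mult_2)
  obtain D where D: "D \<in> carrier_mat (n + 2) (2 * (n + 1))" "D * ?M = 1\<^sub>m (n + 2)"
    using injective_imp_left_inverse[OF M] rank full_column_rank_iff[OF M] by blast
  have split: "sum f {0..<p + p} = sum f {0..<p} + (\<Sum>k\<in>{0..<p}. f (p + k))"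
    for f :: "nat \<Rightarrow> complex" and p
    using sum.atLeastLessThan_concat[of 0 p "p + p" f] sum.shift_bounds_nat_ivl[of f 0 p p]
    by (simp add: add.commute)
  have "(\<Sum>k\<le>n. D $$ (l, k) * \<alpha> $$ (k, m) + D $$ (l, n + 1 + k) * cnj (\<alpha> $$ (n - k, Suc n - m)))
      = (if l = m then 1 else 0)" if lm: "l \<le> Suc n" "m \<le> Suc n" for l m
  proof -
    have "(if l = m then 1 else 0) = (D * ?M) $$ (l, m)" using lm D(2) by simp
    also have "\<dots> = (\<Sum>k\<in>{0..<(n + 1) + (n + 1)}. D $$ (l, k) * ?M $$ (k, m))"
      using lm D(1) M by (auto simp: scalar_prod_def mult_2 intro!: sum.cong)
    also have "\<dots> = (\<Sum>k\<in>{0..<n + 1}. D $$ (l, k) * ?M $$ (k, m)) +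
        (\<Sum>k\<in>{0..<n + 1}. D $$ (l, n + 1 + k) * ?M $$ (n + 1 + k, m))"
      by (rule split)
    also have "\<dots> = (\<Sum>k\<in>{0..<n + 1}. D $$ (l, k) * \<alpha> $$ (k, m) +
        D $$ (l, n + 1 + k) * cnj (\<alpha> $$ (n - k, Suc n - m)))"
      unfolding sum.distrib[symmetric] using lm \<alpha> V
      by (intro sum.cong refl) (auto simp: append_rows_def mat_vee_index[OF \<alpha>])
    finally show ?thesis by (simp add: atLeast0LessThan lessThan_Suc_atMost)
  qed
  then show ?thesis by (intro exI[of _ "\<lambda>l k. D $$ (l, k)"] exI[of _ "\<lambda>l k. D $$ (l, n + 1 + k)"] allI impI)
qed

lemma stacked_rankI:
  assumes \<alpha>: "\<alpha> \<in> carrier_mat (n + 1) (n + 2)"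
    and inj: "\<And>x l. (\<And>k. k \<le> n \<Longrightarrow> (\<Sum>l\<le>Suc n. \<alpha> $$ (k, l) * x l) = 0) \<Longrightarrow>
      (\<And>k. k \<le> n \<Longrightarrow> (\<Sum>l\<le>Suc n. cnj (\<alpha> $$ (n - k, Suc n - l)) * x l) = 0) \<Longrightarrow>
      l \<le> Suc n \<Longrightarrow> x l = 0"
  shows "vec_space.rank (2 * (n + 1)) (\<alpha> @\<^sub>r mat_vee \<alpha>) = n + 2"
proof -
  let ?M = "\<alpha> @\<^sub>r mat_vee \<alpha>"
  have V: "mat_vee \<alpha> \<in> carrier_mat (n + 1) (n + 2)" by (rule mat_vee_carrier[OF \<alpha>])
  have M: "?M \<in> carrier_mat (2 * (n + 1)) (n + 2)"
    using carrier_append_rows[OF \<alpha> V] by (simp add: mult_2)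
  show ?thesis unfolding full_column_rank_iff[OF M]
  proof (intro ballI impI)
    fix v :: "complex vec" assume v: "v \<in> carrier_vec (n + 2)" "?M *\<^sub>v v = 0\<^sub>v (2 * (n + 1))"
    have vec_v: "vec (n + 2) (\<lambda>i. v $ i) = v" using v(1) by auto
    have "?M *\<^sub>v vec (n + 2) (\<lambda>i. v $ i) = 0\<^sub>v (2 * (n + 1))" unfolding vec_v by (rule v(2))
    then have "v $ l = 0" if "l \<le> Suc n" for l
      unfolding stacked_mult_eq_0_iff[OF \<alpha>] using that by (intro inj[of "\<lambda>i. v $ i"]) blast+
    then show "v = 0\<^sub>v (n + 2)" using v(1) by (intro eq_vecI) auto
  qed
qed

lemma full_row_rankI:
  fixes A :: "complex mat"
  assumes A: "A \<in> carrier_mat (Suc n) (Suc m)"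
    and inj: "\<And>y k. (\<And>l. l \<le> m \<Longrightarrow> (\<Sum>k\<le>n. y k * A $$ (k, l)) = 0) \<Longrightarrow> k \<le> n \<Longrightarrow> y k = 0"
  shows "vec_space.rank (Suc n) A = Suc n"
proof (rule full_row_rank[OF A])
  fix y assume y: "y \<in> carrier_vec (Suc n)" "transpose_mat A *\<^sub>v y = 0\<^sub>v (Suc m)"
  have T: "transpose_mat A \<in> carrier_mat (Suc m) (Suc n)" using A by simp
  have yv: "vec (Suc n) (\<lambda>i. y $ i) = y" using y(1) by auto
  have "(\<Sum>k\<le>n. y $ k * A $$ (k, l)) = 0" if "l \<le> m" for l
  proof -
    have "(transpose_mat A *\<^sub>v y) $ l = (\<Sum>k\<le>n. transpose_mat A $$ (l, k) * y $ k)"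
      using mult_mat_vec_index_atMost[OF T, of l "\<lambda>i. y $ i"] that unfolding yv by simp
    also have "\<dots> = (\<Sum>k\<le>n. y $ k * A $$ (k, l))"
      using A that by (intro sum.cong) (auto simp: mult.commute)
    finally show ?thesis using y(2) that by simp
  qed
  then have "y $ k = 0" if "k \<le> n" for k using inj[of "\<lambda>i. y $ i"] that by blast
  then show "y = 0\<^sub>v (Suc n)" using y(1) by (intro eq_vecI) auto
qed

section \<open>Orthonormal systems for a linear functional\<close>

locale functional =
  fixes L :: "(complex \<Rightarrow> complex) \<Rightarrow> complex"
  assumes lin: "linear_functional L"
begin

lemma L_add: "f \<in> poly_space \<Longrightarrow> g \<in> poly_space \<Longrightarrow> L (\<lambda>z. f z + g z) = L f + L g"
  using lin unfolding linear_functional_def by blast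

lemma L_scale: "f \<in> poly_space \<Longrightarrow> L (\<lambda>z. a * f z) = a * L f"
  using lin unfolding linear_functional_def by blast

lemma inner_add_left:
  "f \<in> poly_space \<Longrightarrow> g \<in> poly_space \<Longrightarrow> h \<in> poly_space \<Longrightarrow>
    inner_prod L (\<lambda>z. f z + g z) h = inner_prod L f h + inner_prod L g h"
  using L_add[of "\<lambda>z. f z * cnj (h z)" "\<lambda>z. g z * cnj (h z)"]
  by (simp add: inner_prod_def poly_space_mult poly_space_cnj distrib_right)

lemma inner_scale_left:
  "f \<in> poly_space \<Longrightarrow> h \<in> poly_space \<Longrightarrow> inner_prod L (\<lambda>z. a * f z) h = a * inner_prod L f h"
  using L_scale[of "\<lambda>z. f z * cnj (h z)" a]
  by (simp add: inner_prod_def poly_space_mult poly_space_cnj mult.assoc)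

lemma inner_zero_left: "h \<in> poly_space \<Longrightarrow> inner_prod L (\<lambda>z. 0) h = 0"
  using inner_scale_left[of "\<lambda>z. 0" h 0] poly_space_zero by simp

text \<open>
This replaces Hermitian symmetry where the latter is not yet available: it holds for every functional,
and for the normalised family it turns \<open>\<langle>Q k n, Q l m\<rangle>\<close> into \<open>\<langle>Q (m - l) m, Q (n - k) n\<rangle>\<close>.
\<close>

lemma inner_flip: "inner_prod L f g = inner_prod L (\<lambda>z. cnj (g z)) (\<lambda>z. cnj (f z))"
  by (simp add: inner_prod_def mult.commute)

lemma inner_sum_left:
  assumes "\<And>i. i \<in> I \<Longrightarrow> f i \<in> poly_space" "h \<in> poly_space"
  shows "inner_prod L (\<lambda>z. \<Sum>i\<in>I. c i * f i z) h = (\<Sum>i\<in>I. c i * inner_prod L (f i) h)"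
  using assms(1)
proof (induction I rule: infinite_finite_induct)
  case (insert i I)
  then have "inner_prod L (\<lambda>z. c i * f i z + (\<Sum>i\<in>I. c i * f i z)) h =
      c i * inner_prod L (f i) h + inner_prod L (\<lambda>z. \<Sum>i\<in>I. c i * f i z) h"
    using assms(2) by (subst inner_add_left) (auto intro!: poly_space_pw simp: inner_scale_left)
  then show ?case using insert by simp
qed (use inner_zero_left[OF assms(2)] in auto)

lemma inner_add_right:
  "f \<in> poly_space \<Longrightarrow> g \<in> poly_space \<Longrightarrow> h \<in> poly_space \<Longrightarrow>
    inner_prod L h (\<lambda>z. f z + g z) = inner_prod L h f + inner_prod L h g"
  by (subst (1 2 3) inner_flip) (simp add: inner_add_left poly_space_cnj)

lemma inner_scale_right:
  "f \<in> poly_space \<Longrightarrow> h \<in> poly_space \<Longrightarrow>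
    inner_prod L h (\<lambda>z. a * f z) = cnj a * inner_prod L h f"
  by (subst (1 2) inner_flip) (simp add: inner_scale_left poly_space_cnj)

lemma inner_zero_right: "h \<in> poly_space \<Longrightarrow> inner_prod L h (\<lambda>z. 0) = 0"
  by (subst inner_flip) (simp add: inner_zero_left poly_space_cnj)

lemma inner_sum_right:
  assumes "\<And>i. i \<in> I \<Longrightarrow> f i \<in> poly_space" "h \<in> poly_space"
  shows "inner_prod L h (\<lambda>z. \<Sum>i\<in>I. c i * f i z) = (\<Sum>i\<in>I. cnj (c i) * inner_prod L h (f i))"
  using assms by (subst (1 2) inner_flip) (simp add: inner_sum_left poly_space_cnj)

lemma inner_mult_z: "inner_prod L (\<lambda>z. z * f z) g = inner_prod L f (\<lambda>z. cnj z * g z)"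
  by (simp add: inner_prod_def mult_ac)

text \<open>
The inner product is conjugate linear in its second argument; the outer conjugation makes it linear.
\<close>

lemma linear_cnj_inner_right: "f \<in> poly_space \<Longrightarrow> linear_functional (\<lambda>g. cnj (inner_prod L f g))"
  by (simp add: linear_functional_def inner_add_right inner_scale_right)

lemma inner_zero_on_span:
  assumes "f \<in> poly_space" "S \<subseteq> poly_space" "\<And>u. u \<in> S \<Longrightarrow> inner_prod L f u = 0" "u \<in> fs.span S"
  shows "inner_prod L f u = 0"
  using linear_functional_zero_on_span[OF linear_cnj_inner_right[OF assms(1)] assms(2) _ assms(4)]
    assms(3) by simp

end

text \<open>
The common ground of the two implications: an orthonormal family of the right degrees whose first
levels span. Positive definiteness of \<open>L\<close> is a consequence (\<open>positive_definite_L\<close>).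
\<close>

locale orthonormal_system = functional +
  fixes Q :: "nat \<Rightarrow> nat \<Rightarrow> complex \<Rightarrow> complex"
  assumes sym: "k \<le> n \<Longrightarrow> Q (n - k) n = (\<lambda>z. cnj (Q k n z))"
    and deg: "k \<le> n \<Longrightarrow> Q k n \<in> poly_deg_le (int n)"
    and spanning: "poly_deg_le (int n) \<subseteq> fs.span {Q k m | k m. k \<le> m \<and> m \<le> n}"
    and orthonormal: "k \<le> n \<Longrightarrow> l \<le> m \<Longrightarrow>
      inner_prod L (Q k n) (Q l m) = (if k = l \<and> n = m then 1 else 0)"
begin

lemma Q_poly: "k \<le> n \<Longrightarrow> Q k n \<in> poly_space"
  using deg poly_deg_le_subset_poly_space by blast

lemma levels_subset_poly_space: "fs.span {Q k m | k m. k \<le> m \<and> m \<le> n} \<subseteq> poly_space"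
  by (rule span_subset_poly_space) (auto intro: Q_poly)

text \<open>
Both sides are linear in \<open>f\<close>, and they agree on the spanning functions \<open>Q k m\<close>.
\<close>

lemma expansion:
  assumes "f \<in> poly_deg_le (int n)"
  shows "f z = (\<Sum>m\<le>n. \<Sum>k\<le>m. inner_prod L f (Q k m) * Q k m z)"
proof -
  have "f \<in> fs.span {Q k m | k m. k \<le> m \<and> m \<le> n}" using assms spanning by blast
  then show ?thesis
  proof (induction arbitrary: z rule: span_pointwise_induct)
    case zero
    show ?case by (simp add: inner_zero_left Q_poly)
  next
    case (add f g)
    then have "f \<in> poly_space" "g \<in> poly_space" using levels_subset_poly_space by auto
    then have "inner_prod L (\<lambda>z. f z + g z) (Q k m) * Q k m z =
        inner_prod L f (Q k m) * Q k m z + inner_prod L g (Q k m) * Q k m z" if "k \<le> m" for k m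
      using that by (simp add: inner_add_left Q_poly distrib_right)
    then show ?case using add.IH[of z] by (simp add: sum.distrib)
  next
    case (scale a f)
    then have "f \<in> poly_space" using levels_subset_poly_space by auto
    then have "(\<Sum>m\<le>n. \<Sum>k\<le>m. inner_prod L (\<lambda>z. a * f z) (Q k m) * Q k m z) =
        (\<Sum>m\<le>n. \<Sum>k\<le>m. a * (inner_prod L f (Q k m) * Q k m z))"
      by (intro sum.cong refl) (simp add: inner_scale_left Q_poly)
    then show ?case using scale.IH[of z] by (simp add: sum_distrib_left)
  next
    case (base f)
    then obtain l j where f: "f = Q l j" "l \<le> j" "j \<le> n" by auto
    have "(\<Sum>k\<le>m. inner_prod L f (Q k m) * Q k m z) = (if m = j then Q l j z else 0)" for m
    proof -
      have "(\<Sum>k\<le>m. inner_prod L f (Q k m) * Q k m z) =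
          (\<Sum>k\<le>m. if k = l then (if m = j then Q l j z else 0) else 0)"
        using f by (intro sum.cong) (auto simp: orthonormal)
      then show ?thesis using f by auto
    qed
    then show ?case using f by simp
  qed
qed

lemma lower_spanning: "poly_deg_le (int n - 1) \<subseteq> fs.span {Q k m | k m. k \<le> m \<and> m < n}"
proof (cases n)
  case 0
  then show ?thesis using span_pw_zero by (simp add: poly_deg_le_eq_span zero_fun_def)
next
  case (Suc p)
  then show ?thesis using spanning[of p] by (simp add: less_Suc_eq_le)
qed

lemma Q_orthogonal:
  assumes g: "g \<in> poly_deg_le (int n - 1)" and k: "k \<le> n"
  shows "inner_prod L (Q k n) g = 0"
proof (rule inner_zero_on_span[OF Q_poly[OF k]])
  show "g \<in> fs.span {Q k m | k m. k \<le> m \<and> m < n}" using g lower_spanning by blast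
qed (use k in \<open>auto simp: orthonormal intro: Q_poly\<close>)

lemma orthogonal_Q:
  assumes "g \<in> poly_deg_le (int n - 1)" "k \<le> n"
  shows "inner_prod L g (Q k n) = 0"
proof -
  have "inner_prod L g (Q k n) = inner_prod L (Q (n - k) n) (\<lambda>z. cnj (g z))"
    by (subst inner_flip) (simp add: sym[OF assms(2)])
  then show ?thesis using Q_orthogonal[OF poly_deg_le_cnj[OF assms(1)], of "n - k"] by simp
qed

end

section \<open>From orthonormality to the three-term relation\<close>

context orthonormal_system begin

text \<open>
Expand \<open>g\<close> in the second argument. Hermitian symmetry and positivity of the inner product are both
immediate from this formula.
\<close>

lemma parseval:
  assumes f: "f \<in> poly_space" and g: "g \<in> poly_deg_le (int n)"
  shows "inner_prod L f g = (\<Sum>m\<le>n. \<Sum>k\<le>m. inner_prod L f (Q k m) * cnj (inner_prod L g (Q k m)))"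
proof -
  let ?S = "SIGMA m:{..n}. {..m}"
  have "g = (\<lambda>z. \<Sum>p\<in>?S. inner_prod L g (Q (snd p) (fst p)) * Q (snd p) (fst p) z)"
    unfolding fun_eq_iff using expansion[OF g] by (simp add: sum.Sigma case_prod_beta)
  then have "inner_prod L f g =
      inner_prod L f (\<lambda>z. \<Sum>p\<in>?S. inner_prod L g (Q (snd p) (fst p)) * Q (snd p) (fst p) z)"
    by (rule arg_cong)
  also have "\<dots> = (\<Sum>p\<in>?S. cnj (inner_prod L g (Q (snd p) (fst p))) * inner_prod L f (Q (snd p) (fst p)))"
    using f by (intro inner_sum_right Q_poly) auto
  also have "\<dots> = (\<Sum>m\<le>n. \<Sum>k\<le>m. inner_prod L f (Q k m) * cnj (inner_prod L g (Q k m)))"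
    by (simp add: sum.Sigma case_prod_beta mult.commute)
  finally show ?thesis .
qed

lemma hermitian:
  assumes f: "f \<in> poly_space" and g: "g \<in> poly_space"
  shows "cnj (inner_prod L f g) = inner_prod L g f"
proof -
  obtain m :: nat where m: "f \<in> poly_deg_le (int m)" using f by (rule poly_space_obtain_degree)
  obtain n :: nat where n: "g \<in> poly_deg_le (int n)" using g by (rule poly_space_obtain_degree)
  have "f \<in> poly_deg_le (int (max m n))" "g \<in> poly_deg_le (int (max m n))"
    using m n poly_deg_le_mono[of "int m" "int (max m n)"] poly_deg_le_mono[of "int n" "int (max m n)"]
    by auto
  then show ?thesis using f g by (simp add: parseval mult.commute)
qed

lemma positive_definite_L: "positive_definite L"
  unfolding positive_definite_def
proof (intro ballI impI)
  fix p assume p: "p \<in> poly_space" "p \<noteq> (\<lambda>z. 0)"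
  obtain n :: nat where n: "p \<in> poly_deg_le (int n)" using p(1) by (rule poly_space_obtain_degree)
  define r where "r = (\<Sum>m\<le>n. \<Sum>k\<le>m. (cmod (inner_prod L p (Q k m)))\<^sup>2)"
  have "inner_prod L p p = of_real r"
    unfolding r_def parseval[OF p(1) n] by (simp only: of_real_sum complex_norm_square)
  moreover have "r > 0"
  proof -
    have "r \<ge> 0" unfolding r_def by (intro sum_nonneg) simp
    moreover have "r \<noteq> 0"
    proof
      assume "r = 0"
      then have "inner_prod L p (Q k m) = 0" if "m \<le> n" "k \<le> m" for k m
        using that unfolding r_def by (subst (asm) sum_nonneg_eq_0_iff)
          (auto intro!: sum_nonneg simp: sum_nonneg_eq_0_iff)
      then have "p z = 0" for z by (simp add: expansion[OF n])
      then show False using p(2) by auto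
    qed
    ultimately show ?thesis by simp
  qed
  ultimately show "inner_prod L p p \<in> \<real> \<and> Re (inner_prod L p p) > 0" by simp
qed

lemma level_zero_sum:
  assumes "f \<in> poly_deg_le (int n)" and "\<And>m k. k \<le> m \<Longrightarrow> m < n \<Longrightarrow> inner_prod L f (Q k m) = 0"
  shows "f z = (\<Sum>k\<le>n. inner_prod L f (Q k n) * Q k n z)"
proof -
  have "f z = (\<Sum>m\<le>n. \<Sum>k\<le>m. inner_prod L f (Q k m) * Q k m z)"
    by (rule expansion[OF assms(1)])
  also have "\<dots> = (\<Sum>m\<in>{n}. \<Sum>k\<le>m. inner_prod L f (Q k m) * Q k m z)"
    using assms(2) by (intro sum.mono_neutral_right) auto
  finally show ?thesis by simp
qed

lemma deg_lower: "k \<le> m \<Longrightarrow> m < n \<Longrightarrow> Q k m \<in> poly_deg_le (int n - 1)"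
  using deg[of k m] poly_deg_le_mono[of "int m" "int n - 1"] by auto

lemma makes_basis: "makes_orthonormal_basis L Q"
  unfolding makes_orthonormal_basis_def
proof (intro allI conjI impI ballI)
  fix n k :: nat assume "k \<le> n"
  then show "Q k n \<in> orth_polys L n" unfolding orth_polys_def using deg Q_orthogonal by blast
next
  fix n k l :: nat assume "k \<le> n" "l \<le> n"
  then show "inner_prod L (Q k n) (Q l n) = (if k = l then 1 else 0)" by (simp add: orthonormal)
next
  fix n P assume P: "P \<in> orth_polys L n"
  then have "P z = (\<Sum>k\<le>n. inner_prod L P (Q k n) * Q k n z)" for z
    using deg_lower unfolding orth_polys_def by (intro level_zero_sum) blast+
  then show "\<exists>c. P = (\<lambda>z. \<Sum>k\<le>n. c k * Q k n z)" by (intro exI ext)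
qed

text \<open>
In an orthonormal system the entries of the matrices in the three-term relation can only be the Fourier
coefficients of \<open>z * Q k n\<close>; \<open>\<alpha>\<close> collects those at level \<open>n + 1\<close>, and \<open>\<beta>\<close> those at level \<open>n\<close>.
\<close>

definition \<alpha> :: "nat \<Rightarrow> nat \<Rightarrow> nat \<Rightarrow> complex" where
  "\<alpha> n k l = inner_prod L (\<lambda>z. z * Q k n z) (Q l (Suc n))"

definition \<beta> :: "nat \<Rightarrow> nat \<Rightarrow> nat \<Rightarrow> complex" where
  "\<beta> n k l = inner_prod L (\<lambda>z. z * Q k n z) (Q l n)"

lemma mult_z_deg: "k \<le> n \<Longrightarrow> (\<lambda>z. z * Q k n z) \<in> poly_deg_le (int (Suc n))"
  and mult_cnj_deg: "k \<le> n \<Longrightarrow> (\<lambda>z. cnj z * Q k n z) \<in> poly_deg_le (int (Suc n))"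
  using poly_deg_le_mult_z[OF deg] poly_deg_le_mult_cnj[OF deg] by (simp_all add: add.commute)

text \<open>
The entries of \<open>mat_vee (\<alpha> n)\<close> are the Fourier coefficients of \<open>cnj z * Q k n\<close> at level \<open>n + 1\<close>.
\<close>

lemma cnj_\<alpha>:
  assumes "k \<le> n" "l \<le> Suc n"
  shows "cnj (\<alpha> n (n - k) (Suc n - l)) = inner_prod L (\<lambda>z. cnj z * Q k n z) (Q l (Suc n))"
proof -
  have "(\<lambda>z. z * Q (n - k) n z) \<in> poly_space" by (intro poly_space_mult_z Q_poly) simp
  then have "cnj (\<alpha> n (n - k) (Suc n - l)) =
      inner_prod L (Q (Suc n - l) (Suc n)) (\<lambda>z. z * Q (n - k) n z)"
    unfolding \<alpha>_def by (intro hermitian Q_poly) simp_all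
  also have "\<dots> = inner_prod L (\<lambda>z. cnj z * Q k n z) (Q l (Suc n))"
    using sym[OF assms(1)] sym[OF assms(2)] by (subst inner_flip) simp
  finally show ?thesis .
qed

text \<open>
Since \<open>\<langle>z * Q k n, Q j m\<rangle> = \<langle>Q k n, cnj z * Q j m\<rangle>\<close>, only the levels \<open>n - 1\<close>, \<open>n\<close> and \<open>n + 1\<close> contribute to the
expansion of \<open>z * Q k n\<close>.
\<close>

lemma three_term_relation:
  assumes k: "k \<le> n"
  shows "z * Q k n z = (\<Sum>l\<le>Suc n. \<alpha> n k l * Q l (Suc n) z) + (\<Sum>l\<le>n. \<beta> n k l * Q l n z) +
      (if n = 0 then 0 else \<Sum>l\<le>n - 1. \<alpha> (n - 1) (n - 1 - l) (n - k) * Q l (n - 1) z)"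
proof -
  let ?f = "\<lambda>z. z * Q k n z"
  define T where "T m = (\<Sum>j\<le>m. inner_prod L ?f (Q j m) * Q j m z)" for m
  have T0: "T m = 0" if "Suc m < n" for m
  proof -
    have "(\<lambda>z. cnj z * Q j m z) \<in> poly_deg_le (int n - 1)" if "j \<le> m" for j
      using mult_cnj_deg[OF that] poly_deg_le_mono[of "int (Suc m)" "int n - 1"] \<open>Suc m < n\<close> by auto
    then have "inner_prod L ?f (Q j m) = 0" if "j \<le> m" for j
      using that k by (simp add: inner_mult_z Q_orthogonal)
    then show ?thesis by (simp add: T_def)
  qed
  have "z * Q k n z = (\<Sum>m\<le>Suc n. T m)"
    unfolding T_def by (rule expansion[OF mult_z_deg[OF k]])
  also have "\<dots> = T (Suc n) + T n + (if n = 0 then 0 else T (n - 1))"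
  proof (cases n)
    case (Suc p)
    have "(\<Sum>m\<le>p. T m) = (\<Sum>m\<in>{p}. T m)" using T0 Suc by (intro sum.mono_neutral_right) auto
    then show ?thesis using Suc by simp
  qed simp
  also have "T (n - 1) = (\<Sum>l\<le>n - 1. \<alpha> (n - 1) (n - 1 - l) (n - k) * Q l (n - 1) z)" if "n \<noteq> 0"
  proof -
    have "inner_prod L ?f (Q l (n - 1)) = \<alpha> (n - 1) (n - 1 - l) (n - k)" if "l \<le> n - 1" for l
      using sym[OF that] sym[OF k] \<open>n \<noteq> 0\<close> by (simp add: \<alpha>_def inner_prod_def mult_ac)
    then show ?thesis by (simp add: T_def)
  qed
  then have "(if n = 0 then 0 else T (n - 1)) =
      (if n = 0 then 0 else \<Sum>l\<le>n - 1. \<alpha> (n - 1) (n - 1 - l) (n - k) * Q l (n - 1) z)" by simp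
  finally show ?thesis by (simp only: T_def \<alpha>_def \<beta>_def)
qed

text \<open>
The hypotheses say that \<open>f \<mapsto> (\<Sum>l\<le>n + 1. \<langle>f, Q l (n + 1)\<rangle> * x l)\<close> vanishes on \<open>z * Q k n\<close> and \<open>cnj z * Q k n\<close>. It
vanishes in degree at most \<open>n\<close> by orthogonality, and these polynomials together span degree \<open>n + 1\<close>.
Its value at \<open>Q l (n + 1)\<close> is \<open>x l\<close>.
\<close>

lemma stacked_injective:
  assumes upper: "\<And>k. k \<le> n \<Longrightarrow> (\<Sum>l\<le>Suc n. \<alpha> n k l * x l) = 0"
    and lower: "\<And>k. k \<le> n \<Longrightarrow> (\<Sum>l\<le>Suc n. cnj (\<alpha> n (n - k) (Suc n - l)) * x l) = 0"
    and l: "l \<le> Suc n"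
  shows "x l = 0"
proof -
  define \<phi> where "\<phi> f = (\<Sum>l\<le>Suc n. inner_prod L f (Q l (Suc n)) * x l)" for f
  have add: "\<phi> (\<lambda>z. f z + g z) = \<phi> f + \<phi> g" if "f \<in> poly_space" "g \<in> poly_space" for f g
    unfolding \<phi>_def sum.distrib[symmetric]
    by (intro sum.cong refl) (simp add: inner_add_left that Q_poly distrib_right)
  have scale: "\<phi> (\<lambda>z. a * f z) = a * \<phi> f" if "f \<in> poly_space" for f a
    unfolding \<phi>_def sum_distrib_left
    by (intro sum.cong refl) (simp add: inner_scale_left that Q_poly mult.assoc)
  have lin_mult: "linear_functional (\<lambda>f. \<phi> (\<lambda>z. u z * f z))"
    if u: "\<And>f. f \<in> poly_space \<Longrightarrow> (\<lambda>z. u z * f z) \<in> poly_space" for u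
    unfolding linear_functional_def
  proof (intro conjI ballI allI)
    fix f g assume "f \<in> poly_space" "g \<in> poly_space"
    then show "\<phi> (\<lambda>z. u z * (f z + g z)) = \<phi> (\<lambda>z. u z * f z) + \<phi> (\<lambda>z. u z * g z)"
      using add[OF u u] by (simp add: distrib_left)
  next
    fix a f assume "f \<in> poly_space"
    then show "\<phi> (\<lambda>z. u z * (a * f z)) = a * \<phi> (\<lambda>z. u z * f z)"
      using scale[OF u, of f a] by (simp add: mult.left_commute)
  qed
  have low: "\<phi> f = 0" if "f \<in> poly_deg_le (int n)" for f
    using that orthogonal_Q[of f "Suc n"] by (simp add: \<phi>_def)
  have level: "\<phi> (\<lambda>z. z * Q k m z) = 0" "\<phi> (\<lambda>z. cnj z * Q k m z) = 0" if km: "k \<le> m" "m \<le> n" for k m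
  proof -
    have "\<phi> (\<lambda>z. z * Q k m z) = 0 \<and> \<phi> (\<lambda>z. cnj z * Q k m z) = 0"
    proof (cases "m = n")
      case True
      have "\<phi> (\<lambda>z. z * Q k m z) = (\<Sum>l\<le>Suc n. \<alpha> n k l * x l)"
        by (simp only: \<phi>_def \<alpha>_def True)
      moreover have "\<phi> (\<lambda>z. cnj z * Q k m z) = (\<Sum>l\<le>Suc n. cnj (\<alpha> n (n - k) (Suc n - l)) * x l)"
        unfolding \<phi>_def using km True by (intro sum.cong refl) (simp add: cnj_\<alpha>)
      ultimately show ?thesis using upper lower km True by simp
    next
      case False
      then have "poly_deg_le (int (Suc m)) \<subseteq> poly_deg_le (int n)" using km by (intro poly_deg_le_mono) simp
      then show ?thesis
        using mult_z_deg[OF km(1)] mult_cnj_deg[OF km(1)] by (intro conjI low) auto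
    qed
    then show "\<phi> (\<lambda>z. z * Q k m z) = 0" "\<phi> (\<lambda>z. cnj z * Q k m z) = 0" by simp_all
  qed
  have mult: "\<phi> (\<lambda>z. z * f z) = 0" "\<phi> (\<lambda>z. cnj z * f z) = 0" if f: "f \<in> poly_deg_le (int n)" for f
  proof -
    have f_span: "f \<in> fs.span {Q k m | k m. k \<le> m \<and> m \<le> n}" using f spanning by blast
    show "\<phi> (\<lambda>z. z * f z) = 0"
      by (rule linear_functional_zero_on_span[OF lin_mult[OF poly_space_mult_z] _ _ f_span])
        (auto simp: level intro: Q_poly)
    show "\<phi> (\<lambda>z. cnj z * f z) = 0"
      by (rule linear_functional_zero_on_span[OF lin_mult[OF poly_space_mult_cnj] _ _ f_span])
        (auto simp: level intro: Q_poly)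
  qed
  have "\<phi> f = 0" if f: "f \<in> poly_deg_le (int (Suc n))" for f
  proof (rule linear_functional_zero_on_span[where \<phi> = \<phi>])
    show "linear_functional \<phi>" unfolding linear_functional_def using add scale by blast
    show "f \<in> fs.span (poly_deg_le (int n) \<union> (\<lambda>f z. z * f z) ` poly_deg_le (int n) \<union>
        (\<lambda>f z. cnj z * f z) ` poly_deg_le (int n))"
      using f poly_deg_le_Suc_subset_span by blast
    show "poly_deg_le (int n) \<union> (\<lambda>f z. z * f z) ` poly_deg_le (int n) \<union>
        (\<lambda>f z. cnj z * f z) ` poly_deg_le (int n) \<subseteq> poly_space"
      using poly_deg_le_subset_poly_space poly_space_mult_z poly_space_mult_cnj by blast
  qed (use low mult in auto)
  then have "\<phi> (Q l (Suc n)) = 0" using deg l by blast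
  moreover have "\<phi> (Q l (Suc n)) = (\<Sum>j\<le>Suc n. if l = j then x j else 0)"
    unfolding \<phi>_def using l by (intro sum.cong refl) (simp add: orthonormal)
  moreover have "\<dots> = x l" using l by (simp del: sum.atMost_Suc)
  ultimately show ?thesis by simp
qed

text \<open>
For \<open>q = (\<Sum>k\<le>n. y k * Q k n)\<close> the hypothesis says that \<open>(z + s * cnj z) * q\<close> has no component at level
\<open>n + 1\<close>, so \<open>q\<close> has degree less than \<open>n\<close> by \<open>degree_drop\<close>. But \<open>q\<close> is orthogonal to that degree.
The cases \<open>s = 1\<close> and \<open>s = - 1\<close> give the two rank conditions on single levels.
\<close>

lemma combination_row_injective:
  assumes s: "s \<noteq> 0"
    and y: "\<And>l. l \<le> Suc n \<Longrightarrow> (\<Sum>k\<le>n. y k * (\<alpha> n k l + s * cnj (\<alpha> n (n - k) (Suc n - l)))) = 0"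
    and k: "k \<le> n"
  shows "y k = 0"
proof -
  define q where "q = (\<lambda>z. \<Sum>k\<le>n. y k * Q k n z)"
  have q_deg: "q \<in> poly_deg_le (int n)" unfolding q_def by (intro poly_deg_le_pw deg) simp
  let ?r = "\<lambda>z. (1 * z + s * cnj z) * q z"
  let ?w = "\<lambda>k z. z * Q k n z + s * (cnj z * Q k n z)"
  have r: "?r = (\<lambda>z. \<Sum>k\<le>n. y k * ?w k z)"
    by (simp add: q_def sum_distrib_left algebra_simps sum.distrib fun_eq_iff)
  have w_deg: "?w k \<in> poly_deg_le (int (Suc n))" if "k \<le> n" for k
    using mult_z_deg[OF that] mult_cnj_deg[OF that] by (intro poly_deg_le_pw) auto
  have r_deg: "?r \<in> poly_deg_le (int (Suc n))"
    unfolding r by (rule poly_deg_le_sum, rule poly_deg_le_scale, rule w_deg, simp)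
  have top: "inner_prod L ?r (Q l (Suc n)) = 0" if l: "l \<le> Suc n" for l
  proof -
    have "inner_prod L (?w k) (Q l (Suc n)) = \<alpha> n k l + s * cnj (\<alpha> n (n - k) (Suc n - l))" if "k \<le> n" for k
      using that l Q_poly[of k n]
      by (simp add: \<alpha>_def[of n k] cnj_\<alpha> inner_add_left inner_scale_left poly_space_pw Q_poly
        poly_space_mult_z poly_space_mult_cnj)
    moreover have "inner_prod L ?r (Q l (Suc n)) = (\<Sum>k\<le>n. y k * inner_prod L (?w k) (Q l (Suc n)))"
      unfolding r using w_deg poly_deg_le_subset_poly_space l by (intro inner_sum_left Q_poly) auto
    ultimately show ?thesis using y[OF l] by simp
  qed
  have "?r \<in> poly_deg_le (int n)"
  proof -
    have r_lower: "?r = (\<lambda>z. \<Sum>m\<le>n. \<Sum>k\<le>m. inner_prod L ?r (Q k m) * Q k m z)"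
    proof
      fix z
      have "(\<Sum>k\<le>Suc n. inner_prod L ?r (Q k (Suc n)) * Q k (Suc n) z) = 0"
        using top by (intro sum.neutral) simp
      then show "?r z = (\<Sum>m\<le>n. \<Sum>k\<le>m. inner_prod L ?r (Q k m) * Q k m z)"
        using expansion[OF r_deg, of z] by (simp only: sum.atMost_Suc[of _ n] add_0_right)
    qed
    have "Q k m \<in> poly_deg_le (int n)" if "k \<le> m" "m \<le> n" for k m
      using deg[OF that(1)] poly_deg_le_mono[of "int m" "int n"] that(2) by auto
    then show ?thesis
      by (subst r_lower) (intro poly_deg_le_pw, auto)
  qed
  then have "q \<in> poly_deg_le (int n - 1)" by (rule degree_drop[OF q_deg s])
  then have "inner_prod L q (Q k n) = 0" using k by (rule orthogonal_Q)
  moreover have "inner_prod L q (Q k n) = (\<Sum>j\<le>n. y j * inner_prod L (Q j n) (Q k n))"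
    unfolding q_def using k by (intro inner_sum_left Q_poly) auto
  moreover have "\<dots> = (\<Sum>j\<le>n. if j = k then y j else 0)"
    using k by (intro sum.cong refl) (simp add: orthonormal)
  ultimately show ?thesis using k by simp
qed

end

text \<open>
Two things are missing from \<open>makes_orthonormal_basis\<close>. Orthogonality to higher levels follows from
that to lower levels by \<open>inner_flip\<close>. The levels span because a polynomial of degree at most \<open>n\<close> minus
its Fourier terms of level less than \<open>n\<close> is orthogonal to degree \<open>n - 1\<close>, hence a combination of level \<open>n\<close>.
\<close>

lemma orthonormal_systemI:
  assumes lin: "linear_functional L" and basis: "makes_orthonormal_basis L Q"
    and sym: "\<And>k n. k \<le> n \<Longrightarrow> Q (n - k) n = (\<lambda>z. cnj (Q k n z))"
  shows "orthonormal_system L Q"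
proof -
  interpret functional L by unfold_locales (rule lin)
  have orth: "Q k n \<in> orth_polys L n" if "k \<le> n" for k n
    using basis that unfolding makes_orthonormal_basis_def by blast
  have deg: "Q k n \<in> poly_deg_le (int n)" if "k \<le> n" for k n
    using orth[OF that] unfolding orth_polys_def by blast
  have poly: "Q k n \<in> poly_space" if "k \<le> n" for k n
    using deg[OF that] poly_deg_le_subset_poly_space by blast
  have lower: "inner_prod L (Q k n) (Q l m) = 0" if "k \<le> n" "l \<le> m" "m < n" for k n l m
  proof -
    have "Q l m \<in> poly_deg_le (int n - 1)"
      using deg[OF that(2)] poly_deg_le_mono[of "int m" "int n - 1"] that(3) by auto
    then show ?thesis using orth[OF that(1)] unfolding orth_polys_def by blast
  qed
  have upper: "inner_prod L (Q k n) (Q l m) = 0" if "k \<le> n" "l \<le> m" "n < m" for k n l m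
    using lower[of "m - l" m "n - k" n] that sym[OF that(1)] sym[OF that(2)] by (subst inner_flip) simp
  have orthonormal: "inner_prod L (Q k n) (Q l m) = (if k = l \<and> n = m then 1 else 0)"
    if "k \<le> n" "l \<le> m" for k n l m
  proof (cases n m rule: linorder_cases)
    case equal
    then show ?thesis using basis that unfolding makes_orthonormal_basis_def by simp
  qed (use that lower upper in auto)
  have "poly_deg_le (int n) \<subseteq> fs.span {Q k m | k m. k \<le> m \<and> m \<le> n}" for n
  proof (induction n rule: less_induct)
    case (less n)
    let ?S = "{Q k m | k m. k \<le> m \<and> m \<le> n}"
    have Q_span: "Q k m \<in> fs.span ?S" if "k \<le> m" "m \<le> n" for k m
      using that by (intro fs.span_base) blast
    show ?case
    proof
      fix f assume f: "f \<in> poly_deg_le (int n)"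
      then have fP: "f \<in> poly_space" using poly_deg_le_subset_poly_space by blast
      let ?I = "SIGMA m:{..<n}. {..m}"
      \<comment> \<open>the Fourier part of \<open>f\<close> of level less than \<open>n\<close>\<close>
      define h where "h = (\<lambda>z. \<Sum>p\<in>?I. inner_prod L f (Q (snd p) (fst p)) * Q (snd p) (fst p) z)"
      define g where "g = (\<lambda>z. f z + (-1) * h z)"
      have "Q k m \<in> poly_deg_le (int n)" if "k \<le> m" "m < n" for k m
        using deg[OF that(1)] poly_deg_le_mono[of "int m" "int n"] that(2) by auto
      then have h_deg: "h \<in> poly_deg_le (int n)" unfolding h_def by (intro poly_deg_le_pw) auto
      then have hP: "h \<in> poly_space" using poly_deg_le_subset_poly_space by blast
      have g_deg: "g \<in> poly_deg_le (int n)" unfolding g_def by (intro poly_deg_le_pw f h_deg)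
      then have gP: "g \<in> poly_space" using poly_deg_le_subset_poly_space by blast
      have g_orth: "inner_prod L g (Q k m) = 0" if km: "k \<le> m" "m < n" for k m
      proof -
        have "inner_prod L h (Q k m) =
            (\<Sum>p\<in>?I. inner_prod L f (Q (snd p) (fst p)) * inner_prod L (Q (snd p) (fst p)) (Q k m))"
          unfolding h_def using km by (intro inner_sum_left poly) auto
        also have "\<dots> = (\<Sum>p\<in>?I. if p = (m, k) then inner_prod L f (Q k m) else 0)"
          using km by (intro sum.cong refl) (auto simp: orthonormal split: if_splits)
        also have "\<dots> = inner_prod L f (Q k m)" using km by simp
        finally have "inner_prod L h (Q k m) = inner_prod L f (Q k m)" .
        moreover have "inner_prod L g (Q k m) = inner_prod L f (Q k m) + (-1) * inner_prod L h (Q k m)"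
          unfolding g_def
          using inner_add_left[OF fP poly_space_scale[OF hP, of "-1"] poly[OF km(1)]]
            inner_scale_left[OF hP poly[OF km(1)], of "-1"] by (simp only:)
        ultimately show ?thesis by simp
      qed
      have "inner_prod L g u = 0" if "u \<in> poly_deg_le (int n - 1)" for u
      proof (cases n)
        case 0
        then have "u = (\<lambda>z. 0)" using that by (simp add: poly_deg_le_eq_span zero_fun_def)
        then show ?thesis using gP by (simp add: inner_zero_right)
      next
        case (Suc m)
        show ?thesis
        proof (rule inner_zero_on_span[OF gP])
          show "u \<in> fs.span {Q k i | k i. k \<le> i \<and> i \<le> m}" using that less[of m] Suc by auto
        qed (use poly g_orth Suc in auto)
      qed
      then have "g \<in> orth_polys L n" using g_deg unfolding orth_polys_def by blast
      then obtain c where g: "g = (\<lambda>z. \<Sum>k\<le>n. c k * Q k n z)"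
        using basis unfolding makes_orthonormal_basis_def by blast
      have "g \<in> fs.span ?S" unfolding g using Q_span by (intro span_pw) auto
      moreover have "h \<in> fs.span ?S" unfolding h_def using Q_span by (intro span_pw) auto
      ultimately have "(\<lambda>z. g z + h z) \<in> fs.span ?S" by (rule span_pw_add)
      then show "f \<in> fs.span ?S" by (simp add: g_def)
    qed
  qed
  then show ?thesis using sym deg orthonormal by unfold_locales blast+
qed

section \<open>From the three-term relation to orthonormality\<close>

lemma sum_atMost_rev: "(\<Sum>l\<le>n. f (n - l)) = (\<Sum>l\<le>n. f l)" for f :: "nat \<Rightarrow> 'a :: comm_monoid_add"
  by (rule sum.reindex_bij_witness[of _ "\<lambda>l. n - l" "\<lambda>l. n - l"]) auto

text \<open>
The hypotheses of the converse implication in terms of matrix entries, the rank condition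
being replaced by a left inverse of the stacked matrix.
\<close>

locale three_term_system =
  fixes Q :: "nat \<Rightarrow> nat \<Rightarrow> complex \<Rightarrow> complex"
    and a b :: "nat \<Rightarrow> nat \<Rightarrow> nat \<Rightarrow> complex"
  assumes sym: "k \<le> n \<Longrightarrow> Q (n - k) n = (\<lambda>z. cnj (Q k n z))"
    and Q0: "Q 0 0 = (\<lambda>z. 1)"
    and mult_z: "k \<le> n \<Longrightarrow> z * Q k n z =
      (\<Sum>l\<le>Suc n. a n k l * Q l (Suc n) z) + (\<Sum>l\<le>n. b n k l * Q l n z) +
      (if n = 0 then 0 else \<Sum>l\<le>n - 1. a (n - 1) (n - 1 - l) (n - k) * Q l (n - 1) z)"
    and left_inverse: "\<exists>d e. \<forall>l\<le>Suc n. \<forall>m\<le>Suc n.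
      (\<Sum>k\<le>n. d l k * a n k m + e l k * cnj (a n (n - k) (Suc n - m))) = (if l = m then 1 else 0)"
begin

lemma mult_cnj:
  assumes k: "k \<le> n"
  shows "cnj z * Q k n z =
      (\<Sum>l\<le>Suc n. cnj (a n (n - k) (Suc n - l)) * Q l (Suc n) z) +
      (\<Sum>l\<le>n. cnj (b n (n - k) (n - l)) * Q l n z) +
      (if n = 0 then 0 else \<Sum>l\<le>n - 1. cnj (a (n - 1) l k) * Q l (n - 1) z)"
proof -
  have flip: "cnj (Q l m z) = Q (m - l) m z" if "l \<le> m" for l m
    using sym[OF that] by simp
  have rev: "(\<Sum>l\<le>m. c l * cnj (Q l m z)) = (\<Sum>l\<le>m. c (m - l) * Q l m z)" for c m
    by (subst sum_atMost_rev[symmetric]) (intro sum.cong, auto simp: flip)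
  have "cnj z * Q k n z = cnj (z * Q (n - k) n z)" using sym[OF k] by simp
  also have "\<dots> = (\<Sum>l\<le>Suc n. cnj (a n (n - k) l) * cnj (Q l (Suc n) z)) +
      (\<Sum>l\<le>n. cnj (b n (n - k) l) * cnj (Q l n z)) +
      (if n = 0 then 0 else \<Sum>l\<le>n - 1. cnj (a (n - 1) (n - 1 - l) k) * cnj (Q l (n - 1) z))"
    using k by (subst mult_z) (simp_all del: sum.atMost_Suc)
  also have "(\<Sum>l\<le>n - 1. cnj (a (n - 1) (n - 1 - l) k) * cnj (Q l (n - 1) z)) =
      (\<Sum>l\<le>n - 1. cnj (a (n - 1) l k) * Q l (n - 1) z)"
    unfolding rev
  proof (intro sum.cong refl)
    fix l assume "l \<in> {..n - 1}"
    then have "n - 1 - (n - 1 - l) = l" by simp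
    then show "cnj (a (n - 1) (n - 1 - (n - 1 - l)) k) * Q l (n - 1) z = cnj (a (n - 1) l k) * Q l (n - 1) z"
      by simp
  qed
  finally show ?thesis unfolding rev .
qed

abbreviation levels_upto :: "nat \<Rightarrow> (complex \<Rightarrow> complex) set" where
  "levels_upto n \<equiv> {Q k m | k m. k \<le> m \<and> m \<le> n}"

abbreviation levels_from :: "nat \<Rightarrow> (complex \<Rightarrow> complex) set" where
  "levels_from n \<equiv> {Q k m | k m. k \<le> m \<and> n \<le> m}"

text \<open>
Apply the left inverse of the stacked matrix to the two relations for \<open>z * Q n\<close> and \<open>cnj z * Q n\<close>.
\<close>

lemma Q_step:
  assumes l: "l \<le> Suc n"
  obtains d e c c' where "Q l (Suc n) = (\<lambda>z. (\<Sum>k\<le>n. d k * (z * Q k n z) + e k * (cnj z * Q k n z)) -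
    ((\<Sum>k\<le>n. c k * Q k n z) + (if n = 0 then 0 else \<Sum>k\<le>n - 1. c' k * Q k (n - 1) z)))"
proof -
  from left_inverse[of n] obtain d e where de: "\<And>m. m \<le> Suc n \<Longrightarrow>
      (\<Sum>k\<le>n. d k * a n k m + e k * cnj (a n (n - k) (Suc n - m))) = (if l = m then 1 else 0)"
    using l by metis
  define c where "c j = (\<Sum>k\<le>n. d k * b n k j + e k * cnj (b n (n - k) (n - j)))" for j
  define c' where "c' j = (\<Sum>k\<le>n. d k * a (n - 1) (n - 1 - j) (n - k) + e k * cnj (a (n - 1) j k))" for j
  \<comment> \<open>With \<open>u\<close> and \<open>v\<close> the two halves of the stacked matrix, the inner sum on the right is \<open>1\<close> or \<open>0\<close> by the choice of \<open>d\<close> and \<open>e\<close>.\<close>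
  have swap: "(\<Sum>k\<le>n. d k * (\<Sum>j\<in>J. u k j * x j) + e k * (\<Sum>j\<in>J. v k j * x j)) =
      (\<Sum>j\<in>J. (\<Sum>k\<le>n. d k * u k j + e k * v k j) * x j)" for J :: "nat set" and u v :: "nat \<Rightarrow> nat \<Rightarrow> complex" and x
    unfolding sum_distrib_left sum_distrib_right sum.distrib[symmetric]
    by (subst sum.swap) (simp add: algebra_simps)
  have "(\<Sum>k\<le>n. d k * (z * Q k n z) + e k * (cnj z * Q k n z)) =
      Q l (Suc n) z + ((\<Sum>k\<le>n. c k * Q k n z) +
        (if n = 0 then 0 else \<Sum>k\<le>n - 1. c' k * Q k (n - 1) z))" for z
  proof -
    let ?A = "\<lambda>k. \<Sum>j\<le>Suc n. a n k j * Q j (Suc n) z"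
    let ?A' = "\<lambda>k. \<Sum>j\<le>Suc n. cnj (a n (n - k) (Suc n - j)) * Q j (Suc n) z"
    let ?B = "\<lambda>k. \<Sum>j\<le>n. b n k j * Q j n z"
    let ?B' = "\<lambda>k. \<Sum>j\<le>n. cnj (b n (n - k) (n - j)) * Q j n z"
    let ?C = "\<lambda>k. if n = 0 then 0 else \<Sum>j\<le>n - 1. a (n - 1) (n - 1 - j) (n - k) * Q j (n - 1) z"
    let ?C' = "\<lambda>k. if n = 0 then 0 else \<Sum>j\<le>n - 1. cnj (a (n - 1) j k) * Q j (n - 1) z"
    have "(\<Sum>k\<le>n. d k * (z * Q k n z) + e k * (cnj z * Q k n z)) =
        (\<Sum>k\<le>n. d k * (?A k + ?B k + ?C k) + e k * (?A' k + ?B' k + ?C' k))"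
      by (intro sum.cong refl) (simp only: atMost_iff mult_z mult_cnj)
    also have "\<dots> = (\<Sum>k\<le>n. d k * ?A k + e k * ?A' k) + ((\<Sum>k\<le>n. d k * ?B k + e k * ?B' k) +
        (\<Sum>k\<le>n. d k * ?C k + e k * ?C' k))"
      unfolding sum.distrib[symmetric] by (intro sum.cong refl) (simp only: algebra_simps)
    also have "(\<Sum>k\<le>n. d k * ?A k + e k * ?A' k) = Q l (Suc n) z"
    proof -
      have "(\<Sum>k\<le>n. d k * ?A k + e k * ?A' k) = (\<Sum>j\<le>Suc n. (if l = j then 1 else 0) * Q j (Suc n) z)"
        unfolding swap by (intro sum.cong refl) (simp only: atMost_iff de)
      also have "\<dots> = (\<Sum>j\<le>Suc n. if l = j then Q j (Suc n) z else 0)" by (intro sum.cong) auto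
      finally show ?thesis using l by (simp del: sum.atMost_Suc)
    qed
    also have "(\<Sum>k\<le>n. d k * ?B k + e k * ?B' k) = (\<Sum>k\<le>n. c k * Q k n z)"
      unfolding swap c_def ..
    also have "(\<Sum>k\<le>n. d k * ?C k + e k * ?C' k) = (if n = 0 then 0 else \<Sum>k\<le>n - 1. c' k * Q k (n - 1) z)"
      using swap[of "\<lambda>k j. a (n - 1) (n - 1 - j) (n - k)" "\<lambda>j. Q j (n - 1) z" "{..n - 1}"
          "\<lambda>k j. cnj (a (n - 1) j k)"] by (simp add: c'_def)
    finally show ?thesis .
  qed
  then show ?thesis by (intro that[of d e c c'] ext) (simp only: add_diff_cancel_right')
qed

lemma deg: "k \<le> n \<Longrightarrow> Q k n \<in> poly_deg_le (int n)"
proof (induction n arbitrary: k rule: less_induct)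
  case (less n)
  show ?case
  proof (cases n)
    case 0
    have "zmon (0, 0) = (\<lambda>z. 1)" by (simp add: zmon_apply fun_eq_iff)
    then show ?thesis using 0 less.prems Q0 unfolding poly_deg_le_eq_span
      by (auto intro!: fs.span_base image_eqI[of _ _ "(0, 0)"])
  next
    case (Suc m)
    have Qm: "Q k m \<in> poly_deg_le (int m)" if "k \<le> m" for k using less.IH that Suc by simp
    have up: "f \<in> poly_deg_le (int n)" if "f \<in> poly_deg_le d" "d \<le> int n" for f d
      using poly_deg_le_mono[OF that(2)] that(1) by blast
    have top: "Q k m \<in> poly_deg_le (int n)" "(\<lambda>z. z * Q k m z) \<in> poly_deg_le (int n)"
        "(\<lambda>z. cnj z * Q k m z) \<in> poly_deg_le (int n)" if "k \<le> m" for k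
      using up[OF Qm[OF that]] up[OF poly_deg_le_mult_z[OF Qm[OF that]]]
        up[OF poly_deg_le_mult_cnj[OF Qm[OF that]]] Suc by auto
    have low: "(\<lambda>z. if m = 0 then 0 else \<Sum>k\<le>m - 1. c' k * Q k (m - 1) z) \<in> poly_deg_le (int n)" for c'
    proof (cases "m = 0")
      case False
      then have "Q k (m - 1) \<in> poly_deg_le (int n)" if "k \<le> m - 1" for k
        using that Suc by (intro up[OF less.IH]) auto
      then have "(\<lambda>z. \<Sum>k\<le>m - 1. c' k * Q k (m - 1) z) \<in> poly_deg_le (int n)"
        by (intro poly_deg_le_sum poly_deg_le_scale) simp
      then show ?thesis using False by simp
    qed (simp add: poly_deg_le_zero)
    obtain d e c c' where "Q k n = (\<lambda>z. (\<Sum>k\<le>m. d k * (z * Q k m z) + e k * (cnj z * Q k m z)) -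
        ((\<Sum>k\<le>m. c k * Q k m z) + (if m = 0 then 0 else \<Sum>k\<le>m - 1. c' k * Q k (m - 1) z)))"
      using Q_step[of k m] less.prems Suc by metis
    moreover have "(\<lambda>z. \<Sum>k\<le>m. d k * (z * Q k m z) + e k * (cnj z * Q k m z)) \<in> poly_deg_le (int n)"
      by (intro poly_deg_le_sum poly_deg_le_add poly_deg_le_scale top) simp_all
    moreover have "(\<lambda>z. \<Sum>k\<le>m. c k * Q k m z) \<in> poly_deg_le (int n)"
      by (intro poly_deg_le_sum poly_deg_le_scale top) simp
    ultimately show ?thesis using poly_deg_le_diff[OF _ poly_deg_le_add[OF _ low]] by simp
  qed
qed

lemma Q_poly: "k \<le> n \<Longrightarrow> Q k n \<in> poly_space"
  using deg poly_deg_le_subset_poly_space by blast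

lemma mult_mem_span:
  assumes k: "k \<le> n" and S: "levels_from (n - 1) \<inter> levels_upto (Suc n) \<subseteq> S"
  shows "(\<lambda>z. z * Q k n z) \<in> fs.span S" "(\<lambda>z. cnj z * Q k n z) \<in> fs.span S"
proof -
  have Q: "Q l m \<in> fs.span S" if "l \<le> m" "n - 1 \<le> m" "m \<le> Suc n" for l m
    using that S by (intro fs.span_base) blast
  have comb: "(\<lambda>z. \<Sum>l\<le>m. c l * Q l m z) \<in> fs.span S" if "n - 1 \<le> m" "m \<le> Suc n" for c m
    using that by (intro span_pw_sum fs.span_scale Q) simp_all
  have low: "(\<lambda>z. if n = 0 then 0 else \<Sum>l\<le>n - 1. c l * Q l (n - 1) z) \<in> fs.span S" for c
    using comb[of "n - 1" c] by (cases "n = 0") (simp_all add: span_pw_zero)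
  show "(\<lambda>z. z * Q k n z) \<in> fs.span S"
    unfolding mult_z[OF k] by (rule span_pw_add[OF span_pw_add low]; rule comb; simp)
  show "(\<lambda>z. cnj z * Q k n z) \<in> fs.span S"
    unfolding mult_cnj[OF k] by (rule span_pw_add[OF span_pw_add low]; rule comb; simp)
qed

lemma mult_levels_upto:
  assumes "f \<in> fs.span (levels_upto n)"
  shows "(\<lambda>z. z * f z) \<in> fs.span (levels_upto (Suc n)) \<and> (\<lambda>z. cnj z * f z) \<in> fs.span (levels_upto (Suc n))"
  using assms
proof (induction rule: span_pointwise_induct)
  case (base f)
  then obtain k m where f: "f = Q k m" "k \<le> m" "m \<le> n" by auto
  then have "levels_from (m - 1) \<inter> levels_upto (Suc m) \<subseteq> levels_upto (Suc n)" by fastforce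
  then show ?case using mult_mem_span f by blast
qed (auto simp: distrib_left mult.left_commute intro: span_pw)

text \<open>
Multiplication lowers the level by at most one. This bound yields the orthogonality of different
levels, just as the upper bound in \<open>mult_levels_upto\<close> yields that the levels span.
\<close>

lemma mult_levels_from:
  assumes "f \<in> fs.span (levels_from (Suc n))"
  shows "(\<lambda>z. z * f z) \<in> fs.span (levels_from n) \<and> (\<lambda>z. cnj z * f z) \<in> fs.span (levels_from n)"
  using assms
proof (induction rule: span_pointwise_induct)
  case (base f)
  then obtain k m where f: "f = Q k m" "k \<le> m" "Suc n \<le> m" by auto
  then have "levels_from (m - 1) \<inter> levels_upto (Suc m) \<subseteq> levels_from n" by fastforce
  then show ?case using mult_mem_span f by blast
qed (auto simp: distrib_left mult.left_commute intro: span_pw)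

lemma spanning: "poly_deg_le (int n) = fs.span (levels_upto n)"
proof
  show "fs.span (levels_upto n) \<subseteq> poly_deg_le (int n)"
  proof -
    have "levels_upto n \<subseteq> poly_deg_le (int n)"
    proof
      fix f assume "f \<in> levels_upto n"
      then obtain k m where f: "f = Q k m" "k \<le> m" "m \<le> n" by auto
      then show "f \<in> poly_deg_le (int n)"
        using deg[OF f(2)] poly_deg_le_mono[of "int m" "int n"] by auto
    qed
    then show ?thesis unfolding poly_deg_le_eq_span by (intro fs.span_minimal fs.subspace_span)
  qed
  show "poly_deg_le (int n) \<subseteq> fs.span (levels_upto n)"
  proof (induction n)
    case 0
    have "zmon p \<in> levels_upto 0" if "p \<in> {(i, j). int (i + j) \<le> int 0}" for p
    proof -
      have "p = (0, 0)" using that by auto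
      then have "zmon p = Q 0 0" by (simp add: zmon_apply Q0 fun_eq_iff)
      then show ?thesis by blast
    qed
    then show ?case unfolding poly_deg_le_eq_span by (intro fs.span_mono) blast
  next
    case (Suc n)
    have "fs.span (levels_upto n) \<subseteq> fs.span (levels_upto (Suc n))" by (intro fs.span_mono) force
    then have "poly_deg_le (int n) \<union> (\<lambda>f z. z * f z) ` poly_deg_le (int n) \<union>
        (\<lambda>f z. cnj z * f z) ` poly_deg_le (int n) \<subseteq> fs.span (levels_upto (Suc n))"
      using Suc.IH mult_levels_upto by (intro Un_least image_subsetI) blast+
    then show ?case
      using poly_deg_le_Suc_subset_span[of n] fs.span_minimal[OF _ fs.subspace_span] by blast
  qed
qed

text \<open>
The family indexed like the monomials, \<open>q (i, j)\<close> having degree \<open>i + j\<close>, so that the two can be counted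
against each other.
\<close>

definition q :: "nat \<times> nat \<Rightarrow> complex \<Rightarrow> complex" where
  "q = (\<lambda>(i, j). Q i (i + j))"

lemma Q_eq_q: "k \<le> n \<Longrightarrow> Q k n = q (k, n - k)"
  by (simp add: q_def)

lemma q_image: "q ` {(i, j). i + j \<le> n} = levels_upto n"
proof (intro subset_antisym subsetI)
  fix f assume "f \<in> levels_upto n"
  then obtain k m where "f = Q k m" "k \<le> m" "m \<le> n" by auto
  then show "f \<in> q ` {(i, j). i + j \<le> n}" by (intro image_eqI[of _ _ "(k, m - k)"]) (auto simp: q_def)
qed (force simp: q_def)

lemma range_q: "range q = {Q k m | k m. k \<le> m}"
proof (intro subset_antisym subsetI)
  fix f assume "f \<in> {Q k m | k m. k \<le> m}"
  then obtain k m where "f = Q k m" "k \<le> m" by auto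
  then show "f \<in> range q" by (intro image_eqI[of _ _ "(k, m - k)"]) (auto simp: q_def)
qed (force simp: q_def)

lemma inj_q: "inj q" and independent_q: "fs.independent (range q)"
  using graded_spanning_imp_basis[of q] by (simp_all add: q_image spanning)

lemma poly_space_eq_span_q: "poly_space = fs.span (range q)"
proof
  show "poly_space \<subseteq> fs.span (range q)"
  proof
    fix f assume "f \<in> poly_space"
    then obtain n :: nat where "f \<in> fs.span (levels_upto n)"
      using poly_space_obtain_degree spanning by metis
    moreover have "levels_upto n \<subseteq> range q" unfolding range_q by blast
    ultimately show "f \<in> fs.span (range q)" using fs.span_mono by blast
  qed
  show "fs.span (range q) \<subseteq> poly_space"
    unfolding range_q by (rule span_subset_poly_space) (auto intro: Q_poly)
qed

text \<open>
The coordinate of \<open>f\<close> at \<open>Q 0 0\<close> in the basis \<open>Q\<close>. Orthonormality leaves no other choice: \<open>L (Q k n)\<close>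
must be \<open>\<langle>Q k n, Q 0 0\<rangle>\<close>, as \<open>Q 0 0 = 1\<close>.
\<close>

definition L :: "(complex \<Rightarrow> complex) \<Rightarrow> complex" where
  "L f = fs.representation (range q) f (Q 0 0)"

lemma linear_functional_L: "linear_functional L"
  unfolding linear_functional_def
proof (intro conjI ballI allI)
  fix f g assume "f \<in> poly_space" "g \<in> poly_space"
  then show "L (\<lambda>z. f z + g z) = L f + L g"
    using fs.representation_add[OF independent_q, of g f]
    by (simp add: L_def plus_fun_def poly_space_eq_span_q)
next
  fix a f assume "f \<in> poly_space"
  then show "L (\<lambda>z. a * f z) = a * L f"
    using fs.representation_scale[OF independent_q, of f a]
    by (simp add: L_def poly_space_eq_span_q)
qed

sublocale functional L by unfold_locales (rule linear_functional_L)

lemma L_Q: "k \<le> n \<Longrightarrow> L (Q k n) = (if n = 0 then 1 else 0)"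
proof -
  assume k: "k \<le> n"
  have "Q 0 0 = Q k n \<longleftrightarrow> n = 0"
    using inj_eq[OF inj_q, of "(0, 0)" "(k, n - k)"] Q_eq_q[OF k] Q_eq_q[of 0 0] k by auto
  moreover have "Q k n \<in> range q" using k by (simp add: Q_eq_q)
  ultimately show ?thesis unfolding L_def by (subst fs.representation_basis[OF independent_q]) auto
qed

lemma L_levels_from_1: "f \<in> fs.span (levels_from 1) \<Longrightarrow> L f = 0"
  by (rule linear_functional_zero_on_span[OF linear_functional_L]) (auto simp: L_Q intro: Q_poly)

lemma mult_zmon_levels_from:
  assumes "f \<in> fs.span (levels_from (n + (i + j)))"
  shows "(\<lambda>z. f z * cnj (zmon (i, j) z)) \<in> fs.span (levels_from n)"
  using assms
proof (induction i arbitrary: n)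
  case 0
  then show ?case
  proof (induction j arbitrary: n)
    case (Suc j)
    then have "(\<lambda>z. f z * cnj (zmon (0, j) z)) \<in> fs.span (levels_from (Suc n))" by simp
    then have "(\<lambda>z. z * (f z * cnj (zmon (0, j) z))) \<in> fs.span (levels_from n)"
      using mult_levels_from by blast
    then show ?case by (simp add: zmon_apply mult.left_commute)
  qed (simp add: zmon_apply)
next
  case (Suc i)
  then have "(\<lambda>z. f z * cnj (zmon (i, j) z)) \<in> fs.span (levels_from (Suc n))" by simp
  then have "(\<lambda>z. cnj z * (f z * cnj (zmon (i, j) z))) \<in> fs.span (levels_from n)"
    using mult_levels_from by blast
  then show ?case by (simp add: zmon_apply mult_ac)
qed

lemma Q_orthogonal:
  assumes k: "k \<le> n" and g: "g \<in> poly_deg_le (int n - 1)"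
  shows "inner_prod L (Q k n) g = 0"
proof (rule inner_zero_on_span[OF Q_poly[OF k]])
  show "g \<in> fs.span (zmon ` {(i, j). int (i + j) \<le> int n - 1})"
    using g by (simp only: poly_deg_le_eq_span)
  show "zmon ` {(i, j). int (i + j) \<le> int n - 1} \<subseteq> poly_space"
    unfolding poly_space_eq_span by (auto intro: fs.span_base)
next
  fix u assume "u \<in> zmon ` {(i, j). int (i + j) \<le> int n - 1}"
  then obtain i j where u: "u = zmon (i, j)" "i + j < n" by auto
  have "Q k n \<in> levels_from (1 + (i + j))" using k u(2) by force
  then have "(\<lambda>z. Q k n z * cnj (u z)) \<in> fs.span (levels_from 1)"
    unfolding u(1) by (intro mult_zmon_levels_from fs.span_base)
  then show "inner_prod L (Q k n) u = 0" unfolding inner_prod_def by (rule L_levels_from_1)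
qed

lemma Q_lower_orthogonal:
  assumes "k \<le> n" "l \<le> m" "m < n"
  shows "inner_prod L (Q k n) (Q l m) = 0" "inner_prod L (Q l m) (Q k n) = 0"
proof -
  have "Q l m \<in> poly_deg_le (int n - 1)" if "l \<le> m" for l
    using deg[OF that] poly_deg_le_mono[of "int m" "int n - 1"] assms(3) by auto
  then have orth: "inner_prod L (Q k n) (Q l m) = 0" if "k \<le> n" "l \<le> m" for k l
    using that Q_orthogonal by blast
  show "inner_prod L (Q k n) (Q l m) = 0" using orth assms by blast
  show "inner_prod L (Q l m) (Q k n) = 0"
    using orth[of "n - k" "m - l"] sym[OF assms(1)] sym[OF assms(2)]
    by (subst inner_flip) simp
qed

lemma inner_mult_z_Q:
  assumes k: "k \<le> n" and g: "g \<in> poly_space"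
  shows "inner_prod L (\<lambda>z. z * Q k n z) g =
      (\<Sum>l\<le>Suc n. a n k l * inner_prod L (Q l (Suc n)) g) + (\<Sum>l\<le>n. b n k l * inner_prod L (Q l n) g) +
      (if n = 0 then 0 else \<Sum>l\<le>n - 1. a (n - 1) (n - 1 - l) (n - k) * inner_prod L (Q l (n - 1)) g)"
    (is ?z)
    and "inner_prod L (\<lambda>z. cnj z * Q k n z) g =
      (\<Sum>l\<le>Suc n. cnj (a n (n - k) (Suc n - l)) * inner_prod L (Q l (Suc n)) g) +
      (\<Sum>l\<le>n. cnj (b n (n - k) (n - l)) * inner_prod L (Q l n) g) +
      (if n = 0 then 0 else \<Sum>l\<le>n - 1. cnj (a (n - 1) l k) * inner_prod L (Q l (n - 1)) g)" (is ?c)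
proof -
  have sum: "inner_prod L (\<lambda>z. (\<Sum>l\<le>Suc n. u l * Q l (Suc n) z) + (\<Sum>l\<le>n. v l * Q l n z) +
      (if n = 0 then 0 else \<Sum>l\<le>n - 1. w l * Q l (n - 1) z)) g =
      (\<Sum>l\<le>Suc n. u l * inner_prod L (Q l (Suc n)) g) + (\<Sum>l\<le>n. v l * inner_prod L (Q l n) g) +
      (if n = 0 then 0 else \<Sum>l\<le>n - 1. w l * inner_prod L (Q l (n - 1)) g)" for u v w
  proof -
    have low: "(\<lambda>z. if n = 0 then 0 else \<Sum>l\<le>n - 1. w l * Q l (n - 1) z) \<in> poly_space"
      by (cases "n = 0") (auto intro!: poly_space_pw Q_poly)
    have inner_low: "inner_prod L (\<lambda>z. if n = 0 then 0 else \<Sum>l\<le>n - 1. w l * Q l (n - 1) z) g =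
        (if n = 0 then 0 else \<Sum>l\<le>n - 1. w l * inner_prod L (Q l (n - 1)) g)"
    proof (cases "n = 0")
      case False
      have "inner_prod L (\<lambda>z. \<Sum>l\<le>n - 1. w l * Q l (n - 1) z) g =
          (\<Sum>l\<le>n - 1. w l * inner_prod L (Q l (n - 1)) g)"
        using g by (intro inner_sum_left Q_poly) auto
      then show ?thesis using False by simp
    qed (simp add: inner_zero_left g)
    have parts: "(\<lambda>z. \<Sum>l\<le>m. u l * Q l m z) \<in> poly_space" for u m
      by (intro poly_space_pw Q_poly) simp
    have inner_parts: "inner_prod L (\<lambda>z. \<Sum>l\<le>m. u l * Q l m z) g = (\<Sum>l\<le>m. u l * inner_prod L (Q l m) g)" for u m
      using g by (intro inner_sum_left Q_poly) auto
    show ?thesis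
      by (subst inner_add_left, intro poly_space_pw parts, rule low, rule g,
        subst inner_add_left, rule parts, rule parts, rule g) (simp only: inner_parts inner_low)
  qed
  show ?z unfolding mult_z[OF k] by (rule sum)
  show ?c unfolding mult_cnj[OF k] by (rule sum)
qed
text \<open>
With \<open>g j = \<langle>Q j (n + 1), Q l (n + 1)\<rangle>\<close>, a column of the Gram matrix of level \<open>n + 1\<close>, both halves of the
stacked matrix map \<open>g\<close> to their own column \<open>l\<close>. This is seen by evaluating \<open>\<langle>z * Q k n, Q l (n + 1)\<rangle>\<close> from the
relation at level \<open>n\<close> and, after moving the factor \<open>z\<close> to the other side, from the relation at level \<open>n + 1\<close>,
with the induction hypothesis for level \<open>n\<close>. The left inverse then gives that \<open>g\<close> is a unit vector.
\<close>

lemma gram: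
  assumes "m \<le> n" "l \<le> n"
  shows "inner_prod L (Q m n) (Q l n) = (if m = l then 1 else 0)"
  using assms
proof (induction n arbitrary: m l)
  case 0
  then show ?case using L_Q[of 0 0] by (simp add: inner_prod_def Q0)
next
  case (Suc n)
  define g where "g j = inner_prod L (Q j (Suc n)) (Q l (Suc n))" for j
  have l: "l \<le> Suc n" by fact
  have IH: "inner_prod L (Q j n) (Q (n - k) n) = (if j = n - k then 1 else 0)" if "j \<le> n" for j k
    using Suc.IH[of j "n - k"] that by simp
  have orth: "inner_prod L (Q j m) (Q (n - k) n) = 0" if "j \<le> m" "n < m" for j m k
    using that by (intro Q_lower_orthogonal) simp_all
  have upper: "(\<Sum>j\<le>Suc n. a n k j * g j) = a n k l" if k: "k \<le> n" for k
  proof -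
    have "inner_prod L (\<lambda>z. z * Q k n z) (Q l (Suc n)) = (\<Sum>j\<le>Suc n. a n k j * g j)"
      using k l by (subst inner_mult_z_Q) (auto simp: g_def Q_poly Q_lower_orthogonal simp del: sum.atMost_Suc)
    moreover have "inner_prod L (\<lambda>z. z * Q k n z) (Q l (Suc n)) =
        inner_prod L (\<lambda>z. z * Q (Suc n - l) (Suc n) z) (Q (n - k) n)"
      using sym[OF k] sym[OF l] by (simp add: inner_prod_def mult_ac)
    moreover have "\<dots> = (\<Sum>j\<le>n. a n (n - j) l * (if j = n - k then 1 else 0))"
      using l by (subst inner_mult_z_Q) (auto simp: Q_poly orth IH simp del: sum.atMost_Suc intro!: sum.cong)
    moreover have "\<dots> = (\<Sum>j\<le>n. if j = n - k then a n k l else 0)"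
      using k by (intro sum.cong refl) auto
    ultimately show ?thesis by simp
  qed
  have lower: "(\<Sum>j\<le>Suc n. cnj (a n (n - k) (Suc n - j)) * g j) = cnj (a n (n - k) (Suc n - l))"
    if k: "k \<le> n" for k
  proof -
    have "inner_prod L (\<lambda>z. cnj z * Q k n z) (Q l (Suc n)) =
        (\<Sum>j\<le>Suc n. cnj (a n (n - k) (Suc n - j)) * g j)"
      using k l by (subst inner_mult_z_Q) (auto simp: g_def Q_poly Q_lower_orthogonal simp del: sum.atMost_Suc)
    moreover have "inner_prod L (\<lambda>z. cnj z * Q k n z) (Q l (Suc n)) =
        inner_prod L (\<lambda>z. cnj z * Q (Suc n - l) (Suc n) z) (Q (n - k) n)"
      using sym[OF k] sym[OF l] by (simp add: inner_prod_def mult_ac)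
    moreover have "\<dots> = (\<Sum>j\<le>n. cnj (a n j (Suc n - l)) * (if j = n - k then 1 else 0))"
      using l by (subst inner_mult_z_Q) (auto simp: Q_poly orth IH simp del: sum.atMost_Suc intro!: sum.cong)
    moreover have "\<dots> = (\<Sum>j\<le>n. if j = n - k then cnj (a n (n - k) (Suc n - l)) else 0)"
      by (intro sum.cong refl) auto
    ultimately show ?thesis by simp
  qed
  obtain d e where de: "\<And>j. j \<le> Suc n \<Longrightarrow>
      (\<Sum>k\<le>n. d k * a n k j + e k * cnj (a n (n - k) (Suc n - j))) = (if m = j then 1 else 0)"
    using left_inverse[of n] \<open>m \<le> Suc n\<close> by metis
  have "g m = (\<Sum>j\<le>Suc n. if m = j then g j else 0)" using \<open>m \<le> Suc n\<close> by (simp del: sum.atMost_Suc)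
  also have "\<dots> = (\<Sum>j\<le>Suc n. (if m = j then 1 else 0) * g j)"
    by (intro sum.cong refl) simp
  also have "\<dots> = (\<Sum>j\<le>Suc n. (\<Sum>k\<le>n. d k * a n k j + e k * cnj (a n (n - k) (Suc n - j))) * g j)"
    by (intro sum.cong refl) (simp only: de atMost_iff)
  also have "\<dots> = (\<Sum>k\<le>n. d k * (\<Sum>j\<le>Suc n. a n k j * g j) +
      e k * (\<Sum>j\<le>Suc n. cnj (a n (n - k) (Suc n - j)) * g j))"
    unfolding sum_distrib_left sum_distrib_right sum.distrib[symmetric]
    by (subst sum.swap) (simp add: algebra_simps del: sum.atMost_Suc)
  also have "\<dots> = (\<Sum>k\<le>n. d k * a n k l + e k * cnj (a n (n - k) (Suc n - l)))"
    by (intro sum.cong refl) (simp only: upper lower atMost_iff)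
  also have "\<dots> = (if m = l then 1 else 0)" by (rule de[OF l])
  finally show ?case by (simp only: g_def)
qed

lemma orthonormal_system: "orthonormal_system L Q"
proof
  fix k n l m :: nat assume "k \<le> n" "l \<le> m"
  then show "inner_prod L (Q k n) (Q l m) = (if k = l \<and> n = m then 1 else 0)"
    using gram Q_lower_orthogonal by (cases n m rule: linorder_cases) auto
qed (use sym deg spanning in auto)

end

section \<open>Equivalence of orthonormality and the three-term relation\<close>

theorem theorem5p3:
  fixes Q :: "nat \<Rightarrow> nat \<Rightarrow> complex \<Rightarrow> complex"
  assumes poly: "\<And>n k. k \<le> n \<Longrightarrow> Q k n \<in> poly_space"
    and Q0: "Q 0 0 = (\<lambda>z. 1)"
    and sym: "conj_symmetric Q"
  shows "(\<exists>L. linear_functional L \<and> positive_definite L \<and> makes_orthonormal_basis L Q) \<longleftrightarrow>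
    (\<exists>\<alpha> \<beta> :: nat \<Rightarrow> complex mat. \<forall>n.
       \<alpha> n \<in> carrier_mat (n + 1) (n + 2) \<and>
       \<beta> n \<in> carrier_mat (n + 1) (n + 1) \<and>
       (\<forall>z. z \<cdot>\<^sub>v Qvec Q n z =
          \<alpha> n *\<^sub>v Qvec Q (n + 1) z + \<beta> n *\<^sub>v Qvec Q n z +
          (if n = 0 then 0\<^sub>v (n + 1)
           else mat_vee (mat_adjoint (\<alpha> (n - 1))) *\<^sub>v Qvec Q (n - 1) z)) \<and>
       vec_space.rank (n + 1) (\<alpha> n + mat_vee (\<alpha> n)) = n + 1 \<and>
       vec_space.rank (n + 1) (\<alpha> n - mat_vee (\<alpha> n)) = n + 1 \<and>
       vec_space.rank (2 * (n + 1)) (\<alpha> n @\<^sub>r mat_vee (\<alpha> n)) = n + 2)"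
    (is "?orth \<longleftrightarrow> (\<exists>\<alpha> \<beta>. \<forall>n. ?relation \<alpha> \<beta> n)")
proof
  have sym': "Q (n - k) n = (\<lambda>z. cnj (Q k n z))" if "k \<le> n" for k n
    using sym that unfolding conj_symmetric_def by blast
  {
    assume ?orth
    then obtain L where L: "linear_functional L" "makes_orthonormal_basis L Q" by blast
    interpret orthonormal_system L Q by (rule orthonormal_systemI[OF L sym'])
    define A where "A n = mat (n + 1) (n + 2) (\<lambda>(k, l). \<alpha> n k l)" for n
    define B where "B n = mat (n + 1) (n + 1) (\<lambda>(k, l). \<beta> n k l)" for n
    have A: "A n \<in> carrier_mat (n + 1) (n + 2)" and B: "B n \<in> carrier_mat (n + 1) (n + 1)" for n
      by (simp_all add: A_def B_def)
    have A_index: "A n $$ (k, l) = \<alpha> n k l" if "k \<le> n" "l \<le> Suc n" for n k l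
      using that by (simp add: A_def)
    have B_index: "B n $$ (k, l) = \<beta> n k l" if "k \<le> n" "l \<le> n" for n k l
      using that by (simp add: B_def)
    have V: "mat_vee (A n) \<in> carrier_mat (n + 1) (n + 2)" for n by (rule mat_vee_carrier[OF A])
    have V_index: "mat_vee (A n) $$ (k, l) = cnj (\<alpha> n (n - k) (Suc n - l))" if "k \<le> n" "l \<le> Suc n" for n k l
      using that by (simp add: mat_vee_index[OF A] A_index)
    have "?relation A B n" for n
    proof (intro conjI allI)
      show "A n \<in> carrier_mat (n + 1) (n + 2)" "B n \<in> carrier_mat (n + 1) (n + 1)" by (rule A B)+
      show "z \<cdot>\<^sub>v Qvec Q n z = A n *\<^sub>v Qvec Q (n + 1) z + B n *\<^sub>v Qvec Q n z +
          (if n = 0 then 0\<^sub>v (n + 1) else mat_vee (mat_adjoint (A (n - 1))) *\<^sub>v Qvec Q (n - 1) z)" for z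
        unfolding three_term_relation_iff[where \<alpha> = A and \<beta> = B and n = n, OF A B]
      proof (intro allI impI)
        fix k assume k: "k \<le> n"
        have "(\<Sum>l\<le>Suc n. A n $$ (k, l) * Q l (Suc n) z) = (\<Sum>l\<le>Suc n. \<alpha> n k l * Q l (Suc n) z)"
          "(\<Sum>l\<le>n. B n $$ (k, l) * Q l n z) = (\<Sum>l\<le>n. \<beta> n k l * Q l n z)"
          using k by (intro sum.cong refl; simp add: A_index B_index)+
        moreover have "(\<Sum>l\<le>n - 1. A (n - 1) $$ (n - 1 - l, n - k) * Q l (n - 1) z) =
            (\<Sum>l\<le>n - 1. \<alpha> (n - 1) (n - 1 - l) (n - k) * Q l (n - 1) z)" if "n \<noteq> 0"
          using that by (intro sum.cong refl) (simp add: A_index)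
        ultimately show "z * Q k n z = (\<Sum>l\<le>Suc n. A n $$ (k, l) * Q l (Suc n) z) +
            (\<Sum>l\<le>n. B n $$ (k, l) * Q l n z) +
            (if n = 0 then 0 else \<Sum>l\<le>n - 1. A (n - 1) $$ (n - 1 - l, n - k) * Q l (n - 1) z)"
          using three_term_relation[OF k, of z] by (simp del: sum.atMost_Suc cong: if_cong)
      qed
      \<comment> \<open>one argument for both signs: \<open>s = 1\<close> for the sum and \<open>s = - 1\<close> for the difference\<close>
      have row_rank: "vec_space.rank (Suc n) M = Suc n"
        if M: "M \<in> carrier_mat (Suc n) (Suc (Suc n))" and s: "s \<noteq> 0"
          and index: "\<And>k l. k \<le> n \<Longrightarrow> l \<le> Suc n \<Longrightarrow>
            M $$ (k, l) = \<alpha> n k l + s * cnj (\<alpha> n (n - k) (Suc n - l))" for M s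
      proof (rule full_row_rankI[OF M])
        fix y k
        assume y: "\<And>l. l \<le> Suc n \<Longrightarrow> (\<Sum>k\<le>n. y k * M $$ (k, l)) = 0" and k: "k \<le> n"
        show "y k = 0"
        proof (rule combination_row_injective[OF s _ k])
          fix l assume l: "l \<le> Suc n"
          have "(\<Sum>k\<le>n. y k * (\<alpha> n k l + s * cnj (\<alpha> n (n - k) (Suc n - l)))) =
              (\<Sum>k\<le>n. y k * M $$ (k, l))"
            using l by (intro sum.cong refl) (simp add: index)
          then show "(\<Sum>k\<le>n. y k * (\<alpha> n k l + s * cnj (\<alpha> n (n - k) (Suc n - l)))) = 0"
            using y[OF l] by simp
        qed
      qed
      show "vec_space.rank (n + 1) (A n + mat_vee (A n)) = n + 1"
        using row_rank[of "A n + mat_vee (A n)" 1] A[of n] V[of n] by (simp add: A_index V_index)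
      show "vec_space.rank (n + 1) (A n - mat_vee (A n)) = n + 1"
        using row_rank[of "A n - mat_vee (A n)" "-1"] A[of n] V[of n] by (simp add: A_index V_index minus_carrier_mat)
      show "vec_space.rank (2 * (n + 1)) (A n @\<^sub>r mat_vee (A n)) = n + 2"
      proof (rule stacked_rankI[OF A])
        fix x l
        assume x: "\<And>k. k \<le> n \<Longrightarrow> (\<Sum>l\<le>Suc n. A n $$ (k, l) * x l) = 0"
          "\<And>k. k \<le> n \<Longrightarrow> (\<Sum>l\<le>Suc n. cnj (A n $$ (n - k, Suc n - l)) * x l) = 0"
          and l: "l \<le> Suc n"
        have "(\<Sum>l\<le>Suc n. A n $$ (k, l) * x l) = (\<Sum>l\<le>Suc n. \<alpha> n k l * x l)"
          "(\<Sum>l\<le>Suc n. cnj (A n $$ (n - k, Suc n - l)) * x l) =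
            (\<Sum>l\<le>Suc n. cnj (\<alpha> n (n - k) (Suc n - l)) * x l)" if "k \<le> n" for k
          using that by (intro sum.cong refl; simp add: A_index)+
        then show "x l = 0" using x l by (intro stacked_injective[of n x l]) metis+
      qed
    qed
    then show "\<exists>\<alpha> \<beta>. \<forall>n. ?relation \<alpha> \<beta> n" by blast
  next
    assume "\<exists>\<alpha> \<beta>. \<forall>n. ?relation \<alpha> \<beta> n"
    then obtain \<alpha> \<beta> where rel: "\<And>n. ?relation \<alpha> \<beta> n" by blast
    have \<alpha>: "\<alpha> n \<in> carrier_mat (n + 1) (n + 2)" and \<beta>: "\<beta> n \<in> carrier_mat (n + 1) (n + 1)"
      and rank: "vec_space.rank (2 * (n + 1)) (\<alpha> n @\<^sub>r mat_vee (\<alpha> n)) = n + 2" for n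
      using rel[of n] by blast+
    have comp: "\<forall>k\<le>n. z * Q k n z = (\<Sum>l\<le>Suc n. \<alpha> n $$ (k, l) * Q l (Suc n) z) +
      (\<Sum>l\<le>n. \<beta> n $$ (k, l) * Q l n z) +
      (if n = 0 then 0 else \<Sum>l\<le>n - 1. \<alpha> (n - 1) $$ (n - 1 - l, n - k) * Q l (n - 1) z)" for n z
      using rel[of n] unfolding three_term_relation_iff[where \<alpha> = \<alpha> and \<beta> = \<beta> and n = n, OF \<alpha> \<beta>] by blast
    interpret three_term_system Q "\<lambda>n k l. \<alpha> n $$ (k, l)" "\<lambda>n k l. \<beta> n $$ (k, l)"
    proof
      show "\<exists>d e. \<forall>l\<le>Suc n. \<forall>m\<le>Suc n. (\<Sum>k\<le>n. d l k * \<alpha> n $$ (k, m) +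
          e l k * cnj (\<alpha> n $$ (n - k, Suc n - m))) = (if l = m then 1 else 0)" for n
        by (rule stacked_rank_imp_left_inverse[OF \<alpha> rank])
    qed (use sym' Q0 comp in blast)+
    interpret ortho: orthonormal_system L Q by (rule orthonormal_system)
    show ?orth using linear_functional_L ortho.positive_definite_L ortho.makes_basis by blast
  }
qed

end
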